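(* Let $p\geq5$ be a prime and let $(k,|\cdot|)$ be an ultrametric field of characteristic $p$ with ring of integers $\mathcal{O}_k$. Let $f\in\mathcal{O}_k[[\zeta]]$ be of the form $$f(\zeta)=\zeta\left(1+\sum_{j=2}^{+\infty}a_j\zeta^j\right).$$ Put $\lambda:=a_2^{p-3}\left(\tfrac32a_2^3+a_3^2-a_2a_4\right)$. Suppose that $\lambda\neq0$ and that the reduction $\widetilde f(\zeta)$ of $f$ is $3$-ramified. Then all periodic points of $f$ in the open unit disk of $k$ that are not fixed points lie on the sphere $$\left\{\zeta\in k:|\zeta|=|\lambda|^{\frac1p}\right\}.$$
   Context: An ultrametric field $(k,|\cdot|)$ is a field with a non-Archimedean absolute value; $\mathcal{O}_k=\{a\in k:|a|\le1\}$, its maximal ideal is $\mathfrak{m}_k=\{a\in k:|a|<1\}$ (the open unit disk of $k$), and $\widetilde k=\mathcal{O}_k/\mathfrak{m}_k$ is the residue field. The reduction $\widetilde g\in\widetilde k[[\zeta]]$ of $g\in\mathcal{O}_k[[\zeta]]$ is obtained by reducing each coefficient modulo $\mathfrak{m}_k$. For $\zeta\in\mathfrak{m}_k$, $f(\zeta)$ is the value of the (convergent) power series. A periodic point of $f$ is a point $\zeta_0$ with $f^m(\zeta_0)=\zeta_0$ for some integer $m\geq1$, where $f^m$ is the $m$-fold composition; it is a fixed point if $f(\zeta_0)=\zeta_0$. For a field $F$ of characteristic $p$ and a power series $g\in F[[\zeta]]$ with $g(0)=0$ and $g'(0)=1$, the lower ramification numbers of $g$ are $i_n(g):=\operatorname{ord}\left(\frac{g^{p^n}(\zeta)-\zeta}{\zeta}\right)$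 for integers $n\ge0$, where $\operatorname{ord}$ of a nonzero power series is the lowest degree of its nonzero terms and $\operatorname{ord}(0)=+\infty$. For an integer $b\ge1$, $g$ is called $b$-ramified if $i_n(g)=b(1+p+\dots+p^n)$ for all integers $n\geq0$. *)

theory Defs
  imports
    "HOL-Analysis.Analysis"
    "HOL-Computational_Algebra.Formal_Power_Series"
    "HOL-Library.Extended_Nat"
begin

unbundle no vec_syntax

text \<open>
  The metric of an ultrametric field is the one induced by its absolute value
  \<open>abs_val\<close>, so that the library's limits and series apply.  Neither completeness nor
  nontriviality of the absolute value is required.
\<close>

class ultrametric_field = field + metric_space +
  fixes abs_val :: "'a \<Rightarrow> real"
  assumes dist_abs_val: "dist x y = abs_val (x - y)"
    and abs_val_eq_0_iff: "abs_val x = 0 \<longleftrightarrow> x = 0"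
    and abs_val_mult: "abs_val (x * y) = abs_val x * abs_val y"
    and abs_val_add: "abs_val (x + y) \<le> max (abs_val x) (abs_val y)"

lemma abs_val_nonneg: "0 \<le> abs_val (x :: 'k::ultrametric_field)"
  by (metis dist_abs_val diff_zero zero_le_dist)

lemma abs_val_zero [simp]: "abs_val (0 :: 'k::ultrametric_field) = 0"
  by (simp add: abs_val_eq_0_iff)

lemma abs_val_one [simp]: "abs_val (1 :: 'k::ultrametric_field) = 1"
  using abs_val_mult[of "1 :: 'k" 1] abs_val_eq_0_iff[of "1 :: 'k"] by simp

lemma abs_val_minus [simp]: "abs_val (- x :: 'k::ultrametric_field) = abs_val x"
  by (metis abs_val_zero diff_zero diff_0 dist_abs_val dist_commute)

lemma abs_val_diff: "abs_val (x - y :: 'k::ultrametric_field) \<le> max (abs_val x) (abs_val y)"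
  using abs_val_add[of x "- y"] by simp

lemma abs_val_inverse: "abs_val (inverse x :: 'k::ultrametric_field) = inverse (abs_val x)"
proof (cases "x = 0")
  case False
  then have "abs_val x * abs_val (inverse x) = 1"
    using abs_val_mult[of x "inverse x"] by simp
  then show ?thesis
    by (metis inverse_unique)
qed simp

definition integral_elems :: "'k::ultrametric_field set"
  where "integral_elems = {x. abs_val x \<le> 1}"

definition max_ideal :: "'k::ultrametric_field set"
  where "max_ideal = {x. abs_val x < 1}"

definition residue_rel :: "'k::ultrametric_field \<Rightarrow> 'k \<Rightarrow> bool"
  where "residue_rel x y \<longleftrightarrow>
    x \<in> integral_elems \<and> y \<in> integral_elems \<and> x - y \<in> max_ideal"

lemma residue_rel_iff:
  "residue_rel x y \<longleftrightarrow> abs_val x \<le> 1 \<and> abs_val y \<le> 1 \<and> abs_val (x - y) < 1"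
  by (simp add: residue_rel_def integral_elems_def max_ideal_def)

lemma part_equivp_residue_rel: "part_equivp (residue_rel :: 'k::ultrametric_field \<Rightarrow> _)"
proof (rule part_equivpI)
  show "\<exists>x::'k. residue_rel x x"
    by (rule exI[of _ 0]) (simp add: residue_rel_iff)
  show "symp (residue_rel :: 'k \<Rightarrow> _)"
    by (rule sympI) (metis residue_rel_iff minus_diff_eq abs_val_minus)
  show "transp (residue_rel :: 'k \<Rightarrow> _)"
  proof (rule transpI)
    fix x y z :: 'k
    assume "residue_rel x y" "residue_rel y z"
    moreover have "abs_val (x - z) \<le> max (abs_val (x - y)) (abs_val (y - z))"
      using abs_val_add[of "x - y" "y - z"] by simp
    ultimately show "residue_rel x z"
      by (auto simp: residue_rel_iff)
  qed
qed

text \<open>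
  The residue field.  The relation is reflexive on the ring of integers only, and
  \<open>residue_class\<close> is meaningful on integral elements only.
\<close>

quotient_type (overloaded) 'k residue = "'k::ultrametric_field" / partial: residue_rel
  morphisms rep_residue residue_class
  by (rule part_equivp_residue_rel)

instantiation residue :: (ultrametric_field) field
begin

lift_definition zero_residue :: "'a residue" is 0
  by (simp add: residue_rel_iff)

lift_definition one_residue :: "'a residue" is 1
  by (simp add: residue_rel_iff)

lift_definition plus_residue :: "'a residue \<Rightarrow> 'a residue \<Rightarrow> 'a residue" is "(+)"
proof -
  fix x y u v :: 'a
  assume "residue_rel x y" "residue_rel u v"
  moreover have "abs_val ((x + u) - (y + v)) \<le> max (abs_val (x - y)) (abs_val (u - v))"
    using abs_val_add[of "x - y" "u - v"] by (simp add: algebra_simps)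
  ultimately show "residue_rel (x + u) (y + v)"
    using abs_val_add[of x u] abs_val_add[of y v] by (auto simp: residue_rel_iff)
qed

lift_definition uminus_residue :: "'a residue \<Rightarrow> 'a residue" is uminus
proof -
  fix x y :: 'a
  assume "residue_rel x y"
  moreover have "abs_val (- x - - y) = abs_val (x - y)"
    using abs_val_minus[of "x - y"] by (simp add: algebra_simps)
  ultimately show "residue_rel (- x) (- y)"
    by (simp add: residue_rel_iff)
qed

lift_definition minus_residue :: "'a residue \<Rightarrow> 'a residue \<Rightarrow> 'a residue" is "(-)"
proof -
  fix x y u v :: 'a
  assume "residue_rel x y" "residue_rel u v"
  moreover have "abs_val ((x - u) - (y - v)) \<le> max (abs_val (x - y)) (abs_val (u - v))"
    using abs_val_diff[of "x - y" "u - v"] by (simp add: algebra_simps)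
  ultimately show "residue_rel (x - u) (y - v)"
    using abs_val_diff[of x u] abs_val_diff[of y v] by (auto simp: residue_rel_iff)
qed

lift_definition times_residue :: "'a residue \<Rightarrow> 'a residue \<Rightarrow> 'a residue" is "(*)"
proof -
  fix x y u v :: 'a
  assume *: "residue_rel x y" "residue_rel u v"
  have "abs_val (x * u - y * v) \<le> max (abs_val (x * (u - v))) (abs_val ((x - y) * v))"
    using abs_val_add[of "x * (u - v)" "(x - y) * v"] by (simp add: algebra_simps)
  moreover have "abs_val (x * (u - v)) < 1"
    using * mult_left_le_one_le[OF abs_val_nonneg abs_val_nonneg, of x "u - v"]
    by (auto simp: residue_rel_iff abs_val_mult)
  moreover have "abs_val ((x - y) * v) < 1"
    using * mult_right_le_one_le[OF abs_val_nonneg abs_val_nonneg, of v "x - y"]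
    by (auto simp: residue_rel_iff abs_val_mult)
  moreover have "abs_val (x * u) \<le> 1" "abs_val (y * v) \<le> 1"
    using * by (auto simp: residue_rel_iff abs_val_mult abs_val_nonneg mult_le_one)
  ultimately show "residue_rel (x * u) (y * v)"
    by (auto simp: residue_rel_iff)
qed

lift_definition inverse_residue :: "'a residue \<Rightarrow> 'a residue"
  is "\<lambda>x. if x \<in> max_ideal then 0 else inverse x"
proof -
  fix x y :: 'a
  assume *: "residue_rel x y"
  have le: "abs_val x \<le> max (abs_val y) (abs_val (x - y))" "abs_val y \<le> max (abs_val x) (abs_val (x - y))"
    using abs_val_add[of y "x - y"] abs_val_diff[of x "x - y"] by simp_all
  show "residue_rel (if x \<in> max_ideal then 0 else inverse x)
    (if y \<in> max_ideal then 0 else inverse y)"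
  proof (cases "abs_val x < 1")
    case True
    with * le have "abs_val y < 1"
      by (auto simp: residue_rel_iff)
    with True show ?thesis
      by (simp add: residue_rel_iff max_ideal_def)
  next
    case False
    with * le have n: "abs_val x = 1" "abs_val y = 1"
      by (auto simp: residue_rel_iff)
    then have "x \<noteq> 0" "y \<noteq> 0"
      by auto
    then have "inverse x - inverse y = - (inverse x * (x - y) * inverse y)"
      by (simp add: field_simps)
    then have "abs_val (inverse x - inverse y) = abs_val (x - y)"
      using n by (simp add: abs_val_mult abs_val_inverse)
    with * n show ?thesis
      by (simp add: residue_rel_iff max_ideal_def abs_val_inverse)
  qed
qed

definition divide_residue :: "'a residue \<Rightarrow> 'a residue \<Rightarrow> 'a residue"
  where "divide_residue x y = x * inverse y"

instance
proof
  fix a b c :: "'a residue"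
  have closed: "abs_val (x + y) \<le> 1" "abs_val (x - y) \<le> 1" "abs_val (x * y) \<le> 1"
    if "abs_val x \<le> 1" "abs_val y \<le> 1" for x y :: 'a
    using that abs_val_add[of x y] abs_val_diff[of x y]
    by (auto simp: abs_val_mult abs_val_nonneg mult_le_one)
  show "a + b + c = a + (b + c)"
    by transfer (simp add: residue_rel_iff closed algebra_simps)
  show "a + b = b + a"
    by transfer (simp add: residue_rel_iff closed algebra_simps)
  show "0 + a = a"
    by transfer (simp add: residue_rel_iff closed algebra_simps)
  show "- a + a = 0"
    by transfer (simp add: residue_rel_iff closed algebra_simps)
  show "a - b = a + - b"
    by transfer (simp add: residue_rel_iff closed algebra_simps)
  show "a * b * c = a * (b * c)"
    by transfer (simp add: residue_rel_iff closed algebra_simps)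
  show "a * b = b * a"
    by transfer (simp add: residue_rel_iff closed algebra_simps)
  show "1 * a = a"
    by transfer (simp add: residue_rel_iff closed algebra_simps)
  show "(a + b) * c = a * c + b * c"
    by transfer (simp add: residue_rel_iff closed algebra_simps)
  show "(0 :: 'a residue) \<noteq> 1"
    by transfer (simp add: residue_rel_iff closed algebra_simps)
  show "inverse a * a = 1" if "a \<noteq> 0"
    using that
  proof transfer
    fix x :: 'a
    assume "residue_rel x x" "\<not> residue_rel x 0"
    then have n: "abs_val x = 1"
      by (auto simp: residue_rel_iff)
    then have "x \<noteq> 0"
      by auto
    with n show "residue_rel ((if x \<in> max_ideal then 0 else inverse x) * x) 1"
      by (simp add: residue_rel_iff max_ideal_def)
  qed
  show "a div b = a * inverse b"
    by (rule divide_residue_def)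
  show "inverse (0 :: 'a residue) = 0"
    by transfer (simp add: residue_rel_iff max_ideal_def)
qed

end

lemma residue_class_eq_iff:
  assumes "x \<in> integral_elems" and "y \<in> integral_elems"
  shows "residue_class x = residue_class y \<longleftrightarrow> x - y \<in> max_ideal"
  using assms Quotient3_rel[OF Quotient3_residue, of x y]
  by (simp add: residue_rel_iff integral_elems_def max_ideal_def)

lemma CHAR_residue:
  assumes "prime CHAR('k::ultrametric_field)"
  shows "CHAR('k residue) = CHAR('k)"
proof -
  have "pcr_residue (=) (of_nat n :: 'k) (of_nat n)" for n
  proof (induction n)
    case 0
    show ?case
      using zero_residue.transfer by simp
  next
    case (Suc n)
    then show ?case
      using plus_residue.transfer one_residue.transfer by (auto simp: rel_fun_def)
  qed
  from this[of "CHAR('k)"] have "pcr_residue (=) (0 :: 'k) (of_nat CHAR('k))"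
    by simp
  then have "of_nat CHAR('k) = (0 :: 'k residue)"
    using right_uniqueD[OF residue.right_unique[OF right_unique_eq]] zero_residue.transfer by metis
  then have "CHAR('k residue) dvd CHAR('k)"
    by (simp add: of_nat_eq_0_iff_char_dvd)
  with assms show ?thesis
    by (metis CHAR_not_1' One_nat_def prime_nat_iff)
qed

definition reduce_fps :: "'k::ultrametric_field fps \<Rightarrow> 'k residue fps"
  where "reduce_fps f = Abs_fps (\<lambda>n. residue_class (fps_nth f n))"

definition fps_ord :: "'a::zero fps \<Rightarrow> enat"
  where "fps_ord g = (if g = 0 then \<infinity> else enat (subdegree g))"

definition fps_iter :: "'a::field fps \<Rightarrow> nat \<Rightarrow> 'a fps"
  where "fps_iter g m = (fps_compose g ^^ m) fps_X"

text \<open>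
  Intended for \<^term>\<open>fps_nth g 0 = 0\<close> and \<^term>\<open>fps_nth g 1 = 1\<close>, over a field of
  positive characteristic.
\<close>

definition lower_ram :: "'a::field fps \<Rightarrow> nat \<Rightarrow> enat"
  where "lower_ram g n = fps_ord ((fps_iter g (CHAR('a) ^ n) - fps_X) / fps_X)"

definition b_ramified :: "nat \<Rightarrow> 'a::field fps \<Rightarrow> bool"
  where "b_ramified b g \<longleftrightarrow> (\<forall>n. lower_ram g n = enat (b * (\<Sum>i\<le>n. CHAR('a) ^ i)))"

definition fps_conv_at :: "'k::ultrametric_field fps \<Rightarrow> 'k \<Rightarrow> bool"
  where "fps_conv_at f z \<longleftrightarrow> summable (\<lambda>n. fps_nth f n * z ^ n)"

definition fps_value :: "'k::ultrametric_field fps \<Rightarrow> 'k \<Rightarrow> 'k"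
  where "fps_value f z = (\<Sum>n. fps_nth f n * z ^ n)"

text \<open>
  If the field is complete, a power series with integral coefficients converges at every point
  of the open unit disk.  Since completeness is not assumed, it is required that the points of
  the orbit are defined.
\<close>

definition periodic_point :: "'k::ultrametric_field fps \<Rightarrow> 'k \<Rightarrow> bool"
  where "periodic_point f z \<longleftrightarrow>
    (\<exists>m\<ge>1. (\<forall>i<m. fps_conv_at f ((fps_value f ^^ i) z)) \<and> (fps_value f ^^ m) z = z)"

definition fixed_point :: "'k::ultrametric_field fps \<Rightarrow> 'k \<Rightarrow> bool"
  where "fixed_point f z \<longleftrightarrow> fps_conv_at f z \<and> fps_value f z = z"

end

theory Submission
  imports Defs
begin

text \<open>
  Write \<open>X\<close> for the variable, \<open>f\<^sub>i\<close> for the coefficients of \<open>f\<close> (so \<open>f\<^sub>3 = a\<^sub>2\<close> and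
  \<open>f\<^sub>4 = a\<^sub>3\<close>), and \<open>F\<^sub>n\<close> for the iterate of \<open>f\<close> of order \<open>p ^ n\<close>.  Over the residue field
  \<open>f\<close> is \<open>3\<close>-ramified, hence \<open>\<bar>a\<^sub>2\<bar> < 1 = \<bar>a\<^sub>3\<bar>\<close> and \<open>\<bar>lam\<bar> = \<bar>a\<^sub>2\<bar> ^ (p - 3)\<close>.  Over the field
  itself \<open>f\<close> turns out to be \<open>2\<close>-ramified, and the discrepancy between the two orders is a zero count.

  The quotient \<open>Q = (F\<^sub>n\<^sub>+\<^sub>1 - X) / (F\<^sub>n - X)\<close> has integral coefficients
  (\<open>iter_minus_X_factor\<close>), order \<open>2 p ^ (n + 1)\<close> and, after reduction, order
  \<open>3 p ^ (n + 1)\<close>.  By Newton polygons it has \<open>p ^ (n + 1)\<close> nonzero zeros in the open unit disk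
  of an algebraic closure of the completed field, and the product of their absolute values is
  that of the leading coefficient of \<open>Q\<close>.  A nonfixed periodic point
  has minimal period \<open>p ^ (n + 1)\<close> for some \<open>n\<close> (\<open>cycle_structure\<close>), and its
  cycle already provides that many zeros, all of the same absolute value since \<open>f\<close> preserves
  absolute values.  Thus \<open>\<bar>z\<bar> ^ (p ^ (n + 1))\<close> is the absolute value of the leading coefficient of
  \<open>Q\<close>.  In \<open>abs_val_cycle\<close> this is done without Newton polygons or extensions of the field:
  the points of the cycle are divided out, and comparing orders shows that the remaining factor
  has a unit as leading coefficient.

  It remains to see that this leading coefficient has absolute value \<open>\<bar>lam\<bar> ^ (p ^ n)\<close>
  (\<open>iter_p_power_leading_coeff_ratio\<close>).  In characteristic \<open>p\<close>, \<open>F\<^sub>n\<^sub>+\<^sub>1 - X\<close> is the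
  \<open>p\<close>-th power of the operator \<open>u \<mapsto> u oo F\<^sub>n - u\<close> applied to \<open>X\<close>.  Each application acts
  on the three leading coefficients of \<open>u\<close> linearly, through explicit integers and the leading
  coefficients of \<open>F\<^sub>n - X\<close>; after \<open>p\<close> steps the first two vanish and the third one survives
  (\<open>iter_CHAR_leading_coeff\<close>).  The second and third coefficients of \<open>F\<^sub>n - X\<close> that enter
  are known because \<open>F\<^sub>n\<close> commutes with \<open>f\<close> (\<open>commuting_coeffs\<close>).  With \<open>d\<^sub>n\<close> the leading
  coefficient of \<open>F\<^sub>n - X\<close> the outcome is \<open>\<bar>a\<^sub>2\<bar>\<^sup>2 \<bar>d\<^sub>n\<^sub>+\<^sub>1\<bar> = \<bar>d\<^sub>n\<bar> ^ p\<close>.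
\<close>

unbundle fps_syntax

section \<open>Power series with integral coefficients\<close>

definition integral_fps :: "'k::ultrametric_field fps \<Rightarrow> bool"
  where "integral_fps f \<longleftrightarrow> (\<forall>n. abs_val (f $ n) \<le> 1)"

lemma abs_val_power: "abs_val (x ^ n :: 'k::ultrametric_field) = abs_val x ^ n"
  by (induction n) (simp_all add: abs_val_mult)

lemma abs_val_sum_le:
  assumes "\<And>i. i \<in> A \<Longrightarrow> abs_val (g i :: 'k::ultrametric_field) \<le> b" and "0 \<le> b"
  shows "abs_val (sum g A) \<le> b"
  using assms
proof (induction A rule: infinite_finite_induct)
  case (insert x A)
  then show ?case
    using abs_val_add[of "g x" "sum g A"] by fastforce
qed simp_all

lemma abs_val_prod: "abs_val (prod g A :: 'k::ultrametric_field) = (\<Prod>i\<in>A. abs_val (g i))"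
  by (induction A rule: infinite_finite_induct) (simp_all add: abs_val_mult)

lemma abs_val_of_nat_le_1: "abs_val (of_nat n :: 'k::ultrametric_field) \<le> 1"
proof (induction n)
  case (Suc n)
  then show ?case
    using abs_val_add[of 1 "of_nat n :: 'k"] by simp
qed simp

lemma abs_val_add_eq:
  assumes "abs_val y < abs_val (x :: 'k::ultrametric_field)"
  shows "abs_val (x + y) = abs_val x"
  using assms abs_val_add[of x y] abs_val_diff[of "x + y" y] by simp

lemma abs_val_add_le:
  "abs_val x \<le> b \<Longrightarrow> abs_val y \<le> b \<Longrightarrow> abs_val (x + y :: 'k::ultrametric_field) \<le> b"
  using abs_val_add[of x y] by simp

lemma abs_val_diff_le:
  "abs_val x \<le> b \<Longrightarrow> abs_val y \<le> b \<Longrightarrow> abs_val (x - y :: 'k::ultrametric_field) \<le> b"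
  using abs_val_diff[of x y] by simp

lemma abs_val_mult_le_1:
  "abs_val x \<le> 1 \<Longrightarrow> abs_val y \<le> 1 \<Longrightarrow> abs_val (x * y :: 'k::ultrametric_field) \<le> 1"
  by (simp add: abs_val_mult abs_val_nonneg mult_le_one)

lemma abs_val_of_nat_eq_1:
  assumes "prime CHAR('k::ultrametric_field)" and "\<not> CHAR('k) dvd n"
  shows "abs_val (of_nat n :: 'k) = 1"
proof -
  have "coprime n CHAR('k)" and "CHAR('k) \<noteq> 1"
    using assms by (metis coprime_commute prime_imp_coprime, auto)
  then obtain y m where "n * y = CHAR('k) * m + 1"
    using coprime_bezout_strong by metis
  then have "(of_nat (n * y) :: 'k) = of_nat (CHAR('k) * m + 1)"
    by (rule arg_cong)
  also have "\<dots> = 1"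
    by simp
  finally have "(of_nat (n * y) :: 'k) = 1" .
  then have "abs_val (of_nat n :: 'k) * abs_val (of_nat y :: 'k) = 1"
    by (metis abs_val_mult abs_val_one of_nat_mult)
  then show ?thesis
    using abs_val_of_nat_le_1[of n, where ?'k='k] abs_val_of_nat_le_1[of y, where ?'k='k]
      abs_val_nonneg[of "of_nat n :: 'k"] abs_val_nonneg[of "of_nat y :: 'k"]
    by (smt (verit) mult_left_le)
qed

lemma integral_fps_add: "integral_fps f \<Longrightarrow> integral_fps g \<Longrightarrow> integral_fps (f + g)"
  by (simp add: integral_fps_def abs_val_add_le)

lemma integral_fps_diff: "integral_fps f \<Longrightarrow> integral_fps g \<Longrightarrow> integral_fps (f - g)"
  by (simp add: integral_fps_def abs_val_diff_le)

lemma integral_fps_mult: "integral_fps f \<Longrightarrow> integral_fps g \<Longrightarrow> integral_fps (f * g)"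
  unfolding integral_fps_def fps_mult_nth
  by (intro allI abs_val_sum_le abs_val_mult_le_1) simp_all

lemma integral_fps_0: "integral_fps 0"
  by (simp add: integral_fps_def)

lemma integral_fps_1: "integral_fps 1"
  by (simp add: integral_fps_def)

lemma integral_fps_X: "integral_fps fps_X"
  by (simp add: integral_fps_def fps_X_def)

lemma integral_fps_power: "integral_fps f \<Longrightarrow> integral_fps (f ^ n)"
  by (induction n) (simp_all add: integral_fps_1 integral_fps_mult)

lemma integral_fps_sum: "(\<And>i. i \<in> A \<Longrightarrow> integral_fps (g i)) \<Longrightarrow> integral_fps (sum g A)"
  by (induction A rule: infinite_finite_induct) (simp_all add: integral_fps_0 integral_fps_add)

lemma integral_fps_compose: "integral_fps f \<Longrightarrow> integral_fps g \<Longrightarrow> integral_fps (f oo g)"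
  unfolding integral_fps_def[of "f oo g"] fps_compose_nth
  by (intro allI abs_val_sum_le abs_val_mult_le_1)
    (use integral_fps_power[of g] in \<open>simp_all add: integral_fps_def\<close>)

text \<open>
  The recursion for the coefficients of the inverse divides by the constant term only.
\<close>

lemma integral_fps_inverse:
  assumes "integral_fps f" and "abs_val (f $ 0) = 1"
  shows "integral_fps (inverse f)"
  unfolding integral_fps_def
proof
  fix n
  have f0: "f $ 0 \<noteq> 0"
    using assms(2) by auto
  have eq: "inverse f * f = 1"
    by (rule inverse_mult_eq_1) (rule f0)
  show "abs_val (inverse f $ n) \<le> 1"
  proof (induction n rule: less_induct)
    case (less n)
    have "(inverse f * f) $ n = (\<Sum>i<n. inverse f $ i * f $ (n - i)) + inverse f $ n * f $ 0"
      by (simp add: fps_mult_nth atLeast0AtMost lessThan_Suc_atMost[symmetric])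
    then have "inverse f $ n * f $ 0 = 1 $ n - (\<Sum>i<n. inverse f $ i * f $ (n - i))"
      unfolding eq by (simp add: algebra_simps)
    also have "abs_val \<dots> \<le> 1"
      using assms(1) less
      by (intro abs_val_diff_le abs_val_sum_le abs_val_mult_le_1)
        (auto simp: integral_fps_def integral_fps_1[unfolded integral_fps_def])
    finally show ?case
      using assms(2) by (simp add: abs_val_mult)
  qed
qed

section \<open>Evaluation as divisibility\<close>

text \<open>
  If the integral series \<open>f\<close> converges at a point \<open>z\<close> of the open unit disk, with value \<open>v\<close>,
  then \<open>f - v\<close> is divisible by \<open>X - z\<close>: the coefficients of the quotient are the tails of the
  series, divided by powers of \<open>z\<close>.  Taking this divisibility as the notion of evaluation
  replaces limits by ring theory over a field that may be incomplete; composition of series and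
  division by zeros become formal manipulations.
\<close>

definition evals :: "'k::ultrametric_field fps \<Rightarrow> 'k \<Rightarrow> 'k \<Rightarrow> bool"
  where "evals f z v \<longleftrightarrow>
    (\<exists>h. integral_fps h \<and> f - fps_const v = (fps_X - fps_const z) * h)"

lemma nth_X_minus_const_mult:
  "((fps_X - fps_const z) * h) $ 0 = - z * h $ 0"
  "((fps_X - fps_const z) * h) $ Suc n = h $ n - z * h $ Suc n"
  for z :: "'k::field"
  by (simp_all add: left_diff_distrib)

text \<open>
  Multiplication by \<open>X - z\<close> does not decrease the Gauss norm: solving for \<open>h\<close> from the top,
  each step costs a factor \<open>abs_val z < 1\<close>, so the a priori bound \<open>B\<close> disappears in the limit.
\<close>

lemma gauss_norm_X_minus_const:
  fixes z :: "'k::ultrametric_field"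
  assumes "abs_val z < 1"
    and B: "\<And>n. abs_val (h $ n) \<le> B"
    and b: "\<And>n. abs_val (((fps_X - fps_const z) * h) $ Suc n) \<le> b"
  shows "abs_val (h $ n) \<le> b"
proof -
  have *: "abs_val (h $ n) \<le> max b (abs_val z ^ N * B)" for n N
  proof (induction N arbitrary: n)
    case (Suc N)
    have h: "h $ n = ((fps_X - fps_const z) * h) $ Suc n + z * h $ Suc n"
      unfolding nth_X_minus_const_mult by simp
    have "abs_val (z * h $ Suc n) \<le> abs_val z * max b (abs_val z ^ N * B)"
      by (simp add: abs_val_mult abs_val_nonneg mult_left_mono Suc.IH)
    also have "\<dots> \<le> max b (abs_val z ^ Suc N * B)"
    proof -
      have "0 \<le> b"
        using b abs_val_nonneg order_trans by blast
      then have "abs_val z * b \<le> b"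
        using assms(1) abs_val_nonneg[of z] by (simp add: mult_left_le_one_le)
      then show ?thesis
        by (auto simp: max_def mult.assoc)
    qed
    finally show ?case
      using b[of n] by (subst h, intro abs_val_add_le) auto
  qed (use B in \<open>simp add: le_max_iff_disj\<close>)
  have "(\<lambda>N. max b (abs_val z ^ N * B)) \<longlonglongrightarrow> max b (0 * B)"
    using assms(1) abs_val_nonneg[of z]
    by (intro tendsto_intros LIMSEQ_power_zero) simp
  moreover have "0 \<le> b"
    using b abs_val_nonneg order_trans by blast
  ultimately show ?thesis
    using * by (intro LIMSEQ_le_const[of _ b]) (auto simp: max_def)
qed

lemma evals_unique:
  assumes "evals f z v" and "evals f z v'" and "abs_val z < 1"
  shows "v = v'"
proof -
  obtain h h' where h: "integral_fps h" "f - fps_const v = (fps_X - fps_const z) * h"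
    and h': "integral_fps h'" "f - fps_const v' = (fps_X - fps_const z) * h'"
    using assms unfolding evals_def by blast
  have eq: "(fps_X - fps_const z) * (h - h') = fps_const (v' - v)"
    unfolding right_diff_distrib h(2)[symmetric] h'(2)[symmetric] by simp
  have "abs_val ((h - h') $ n) \<le> 0" for n
  proof (rule gauss_norm_X_minus_const[OF assms(3)])
    show "abs_val ((h - h') $ n) \<le> 1" for n
      using integral_fps_diff[OF h(1) h'(1)] by (simp add: integral_fps_def)
    show "abs_val (((fps_X - fps_const z) * (h - h')) $ Suc n) \<le> 0" for n
      unfolding eq by simp
  qed
  from this[of 0] have "(h - h') $ 0 = 0"
    using abs_val_nonneg[of "(h - h') $ 0"] abs_val_eq_0_iff[of "(h - h') $ 0"] by simp
  then show ?thesis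
    using nth_X_minus_const_mult(1)[of z "h - h'"] unfolding eq by simp
qed

lemma evals_X: "evals fps_X z z"
  unfolding evals_def by (rule exI[of _ 1]) (simp add: integral_fps_1)

lemma evals_diff:
  assumes "evals f z v" and "evals g z w"
  shows "evals (f - g) z (v - w)"
proof -
  obtain h h' where h: "integral_fps h" "integral_fps h'"
    and "f - fps_const v = (fps_X - fps_const z) * h" "g - fps_const w = (fps_X - fps_const z) * h'"
    using assms unfolding evals_def by blast
  then have "(f - fps_const v) - (g - fps_const w) = (fps_X - fps_const z) * (h - h')"
    by (simp only: right_diff_distrib)
  moreover have "(f - fps_const v) - (g - fps_const w) = (f - g) - fps_const (v - w)"
    by (rule fps_ext) simp
  ultimately show ?thesis
    using h integral_fps_diff unfolding evals_def by metis
qed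

lemma evals_mult_0:
  assumes "evals f z 0" and "integral_fps g"
  shows "evals (f * g) z 0"
proof -
  obtain h where "integral_fps h" "f = (fps_X - fps_const z) * h"
    using assms unfolding evals_def by auto
  then show ?thesis
    using assms(2) unfolding evals_def
    by (intro exI[of _ "h * g"]) (simp add: integral_fps_mult mult.assoc)
qed

text \<open>
  Modulo \<open>X - z\<close> the factor \<open>u\<close> is the nonzero constant \<open>c\<close>.  Division by \<open>c\<close> produces a
  quotient of \<open>g\<close> by \<open>X - z\<close> that is at first only bounded; it is integral because its Gauss norm
  is that of \<open>g\<close>.
\<close>

lemma evals_mult_0_cancel:
  assumes "evals u z c" and "c \<noteq> 0" and "evals (u * g) z 0"
    and "integral_fps g" and "abs_val z < 1"
  shows "evals g z 0"
proof -
  obtain K where K: "integral_fps K" "u - fps_const c = (fps_X - fps_const z) * K"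
    using assms unfolding evals_def by blast
  obtain H where H: "integral_fps H" "u * g = (fps_X - fps_const z) * H"
    using assms unfolding evals_def by auto
  define h where "h = fps_const (inverse c) * (H - K * g)"
  have "fps_const c * g = u * g - (u - fps_const c) * g"
    by (simp add: left_diff_distrib)
  also have "\<dots> = (fps_X - fps_const z) * (H - K * g)"
    unfolding H(2) K(2) by (simp only: right_diff_distrib mult.assoc)
  finally have cg: "fps_const c * g = (fps_X - fps_const z) * (H - K * g)" .
  have "g = (fps_const (inverse c) * fps_const c) * g"
    using assms(2) by simp
  also have "\<dots> = fps_const (inverse c) * (fps_const c * g)"
    by (rule mult.assoc)
  also have "\<dots> = (fps_X - fps_const z) * h"
    unfolding cg h_def by (rule mult.left_commute)
  finally have g: "g = (fps_X - fps_const z) * h" .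
  have bound: "abs_val (h $ n) \<le> abs_val (inverse c)" for n
  proof -
    have "abs_val ((H - K * g) $ n) \<le> 1"
      using integral_fps_diff[OF H(1) integral_fps_mult[OF K(1) assms(4)]]
      unfolding integral_fps_def by blast
    then show ?thesis
      unfolding h_def by (simp add: abs_val_mult abs_val_nonneg mult_left_le)
  qed
  have "abs_val (h $ n) \<le> 1" for n
  proof (rule gauss_norm_X_minus_const[OF assms(5) bound])
    show "abs_val (((fps_X - fps_const z) * h) $ Suc n) \<le> 1" for n
      using assms(4) unfolding g[symmetric] integral_fps_def by blast
  qed
  then have "integral_fps h"
    unfolding integral_fps_def by blast
  moreover have "g - fps_const 0 = (fps_X - fps_const z) * h"
    using g by simp
  ultimately show ?thesis
    unfolding evals_def by blast
qed

lemma evals_compose: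
  assumes "evals f w v" and "evals g z w" and "g $ 0 = 0" and "integral_fps g"
  shows "evals (f oo g) z v"
proof -
  obtain h where h: "integral_fps h" "f - fps_const v = (fps_X - fps_const w) * h"
    using assms unfolding evals_def by blast
  obtain h' where h': "integral_fps h'" "g - fps_const w = (fps_X - fps_const z) * h'"
    using assms unfolding evals_def by blast
  have "(f oo g) - fps_const v = (f - fps_const v) oo g"
    by (simp add: fps_compose_sub_distrib)
  also have "\<dots> = (g - fps_const w) * (h oo g)"
    unfolding h(2) by (simp add: fps_compose_mult_distrib[OF assms(3)] fps_compose_sub_distrib
        fps_X_fps_compose_startby0[OF assms(3)])
  also have "\<dots> = (fps_X - fps_const z) * (h' * (h oo g))"
    unfolding h'(2) by (simp add: mult.assoc)
  finally have "(f oo g) - fps_const v = (fps_X - fps_const z) * (h' * (h oo g))" .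
  moreover have "integral_fps (h' * (h oo g))"
    using h(1) h'(1) assms(4) by (intro integral_fps_mult integral_fps_compose)
  ultimately show ?thesis
    unfolding evals_def by blast
qed

lemma evals_fps_value:
  fixes f :: "'k::ultrametric_field fps"
  assumes "integral_fps f" and "abs_val z < 1" and "fps_conv_at f z"
  shows "evals f z (fps_value f z)"
proof -
  define v where "v = fps_value f z"
  have sums: "(\<lambda>n. f $ n * z ^ n) sums v"
    using assms(3) unfolding fps_conv_at_def v_def fps_value_def by (rule summable_sums)
  show ?thesis
    unfolding v_def[symmetric]
  proof (cases "z = 0")
    case True
    have "(\<lambda>n. f $ n * z ^ n) sums (\<Sum>n\<in>{0}. f $ n * z ^ n)"
      by (rule sums_finite) (use True in auto)
    then have "v = f $ 0"
      using sums sums_unique2 by fastforce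
    moreover have "f - fps_const (f $ 0) = fps_X * fps_shift 1 f"
      by (rule fps_ext) (simp add: fps_X_mult_nth)
    ultimately show "evals f z v"
      using True assms(1) unfolding evals_def
      by (intro exI[of _ "fps_shift 1 f"]) (simp add: integral_fps_def)
  next
    case False
    then have pos: "0 < abs_val z"
      by (metis abs_val_eq_0_iff abs_val_nonneg less_eq_real_def)
    define P where "P N = (\<Sum>n<N. f $ n * z ^ n)" for N
    have tail: "abs_val (v - P N) \<le> abs_val z ^ N" for N
    proof -
      have "P \<longlonglongrightarrow> v"
        using sums unfolding sums_def P_def .
      then have "eventually (\<lambda>M. dist (P M) v < abs_val z ^ N) sequentially"
        using pos by (intro tendstoD) auto
      then obtain M where "M \<ge> N" and M: "dist (P M) v < abs_val z ^ N"
        unfolding eventually_sequentially by (metis nle_le)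
      have "P M - P N = (\<Sum>n=N..<M. f $ n * z ^ n)"
        unfolding P_def using \<open>M \<ge> N\<close>
        by (simp add: lessThan_atLeast0 sum_diff_nat_ivl)
      also have "abs_val \<dots> \<le> abs_val z ^ N"
      proof (rule abs_val_sum_le)
        fix n assume "n \<in> {N..<M}"
        then have "abs_val z ^ n \<le> abs_val z ^ N"
          using assms(2) pos by (intro power_decreasing) auto
        moreover have "abs_val (f $ n) * abs_val z ^ n \<le> abs_val z ^ n"
          using assms(1) pos by (intro mult_left_le_one_le) (auto simp: integral_fps_def abs_val_nonneg)
        ultimately show "abs_val (f $ n * z ^ n) \<le> abs_val z ^ N"
          by (simp add: abs_val_mult abs_val_power)
      qed (use pos in simp)
      finally have "abs_val (P M - P N) \<le> abs_val z ^ N" .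
      moreover have "abs_val (v - P M) \<le> abs_val z ^ N"
        using M by (simp add: dist_commute flip: dist_abs_val)
      ultimately have "abs_val ((v - P M) + (P M - P N)) \<le> abs_val z ^ N"
        by (intro abs_val_add_le)
      then show ?thesis
        by simp
    qed
    define h where "h = Abs_fps (\<lambda>N. (v - P (Suc N)) / z ^ Suc N)"
    have "integral_fps h"
      unfolding integral_fps_def
    proof
      fix N
      have "abs_val (h $ N) = abs_val (v - P (Suc N)) / abs_val z ^ Suc N"
        unfolding h_def
        by (simp only: fps_nth_Abs_fps divide_inverse abs_val_mult abs_val_inverse abs_val_power)
      also have "\<dots> \<le> 1"
        using tail[of "Suc N"] pos by (simp del: power_Suc)
      finally show "abs_val (h $ N) \<le> 1" .
    qed
    moreover have "f - fps_const v = (fps_X - fps_const z) * h"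
    proof (rule fps_ext)
      fix n
      show "(f - fps_const v) $ n = ((fps_X - fps_const z) * h) $ n"
        using False
        by (cases n) (simp_all add: nth_X_minus_const_mult h_def P_def field_simps)
    qed
    ultimately show "evals f z v"
      unfolding evals_def by blast
  qed
qed

text \<open>
  The two lowest coefficients of \<open>f - v = (X - z) * h\<close> give \<open>v = z * h\<^sub>0\<close> and
  \<open>1 = h\<^sub>0 - z * h\<^sub>1\<close>.
\<close>

lemma abs_val_evals:
  assumes "evals f z v" and "f $ 0 = 0" and "f $ 1 = 1" and "abs_val z < 1"
  shows "abs_val v = abs_val z"
proof -
  obtain h where h: "integral_fps h" "f - fps_const v = (fps_X - fps_const z) * h"
    using assms unfolding evals_def by blast
  have "v = z * h $ 0"
    using arg_cong[OF h(2), of "\<lambda>g. g $ 0"] assms(2) by (simp add: nth_X_minus_const_mult)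
  moreover have "h $ 0 = 1 + z * h $ 1"
    using arg_cong[OF h(2), of "\<lambda>g. g $ Suc 0"] assms(3)
    by (simp add: nth_X_minus_const_mult algebra_simps)
  moreover have "abs_val (z * h $ 1) < 1"
    using assms(4) h(1) abs_val_nonneg[of z] abs_val_nonneg[of "h $ 1"]
    by (auto simp: abs_val_mult integral_fps_def intro: le_less_trans[OF mult_right_le_one_le])
  ultimately show ?thesis
    by (simp add: abs_val_mult abs_val_add_eq)
qed

text \<open>
  Once a zero \<open>z\<close> is split off, the other points of \<open>Z\<close> are still zeros of the quotient, because
  \<open>X - z\<close> takes a nonzero value there.
\<close>

lemma evals_0_factor:
  assumes "finite Z" and "integral_fps Q"
    and "\<And>z. z \<in> Z \<Longrightarrow> abs_val z < 1" and "\<And>z. z \<in> Z \<Longrightarrow> evals Q z 0"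
  shows "\<exists>h. integral_fps h \<and> Q = (\<Prod>z\<in>Z. fps_X - fps_const z) * h"
  using assms
proof (induction Z arbitrary: Q rule: finite_induct)
  case (insert z Z)
  obtain h where h: "integral_fps h" "Q = (fps_X - fps_const z) * h"
    using insert.prems(3)[of z] unfolding evals_def by auto
  have "evals h y 0" if "y \<in> Z" for y
  proof (rule evals_mult_0_cancel)
    show "evals (fps_X - fps_const z) y (y - z)"
      unfolding evals_def
      by (rule exI[of _ 1]) (simp add: integral_fps_1 fps_const_sub[symmetric] del: fps_const_sub)
    show "y - z \<noteq> 0"
      using that insert.hyps by auto
    show "evals ((fps_X - fps_const z) * h) y 0"
      using insert.prems(3)[of y] that h(2) by simp
  qed (use insert.prems that h(1) in auto)
  then obtain h' where "integral_fps h'" "h = (\<Prod>z\<in>Z. fps_X - fps_const z) * h'"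
    using insert.IH[OF h(1)] insert.prems(2) by blast
  then show ?case
    using insert.hyps h(2) by (auto simp: mult.assoc)
qed auto

section \<open>Difference quotients of compositions\<close>

text \<open>
  \<open>u oo \<phi> - u\<close> is divisible by \<open>\<phi> - X\<close>, because \<open>\<phi> ^ n - X ^ n\<close> is.  The quotient is written
  down coefficientwise so that its integrality and its lowest coefficients can be read off; the
  sum is finite because the \<open>n\<close>-th summand has order at least \<open>n - 1\<close>.
\<close>

definition pow_quot :: "'a::field fps \<Rightarrow> nat \<Rightarrow> 'a fps"
  where "pow_quot \<phi> n = (\<Sum>i<n. fps_X ^ (n - Suc i) * \<phi> ^ i)"

definition diff_quot :: "'a::field fps \<Rightarrow> 'a fps \<Rightarrow> 'a fps"
  where "diff_quot u \<phi> = Abs_fps (\<lambda>m. \<Sum>n\<le>Suc m. u $ n * pow_quot \<phi> n $ m)"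

lemma pow_quot_eq:
  assumes "\<phi> $ 0 = 0"
  shows "pow_quot \<phi> n = fps_X ^ (n - 1) * (\<Sum>i<n. fps_shift 1 \<phi> ^ i)"
proof -
  have "\<phi> = fps_X * fps_shift 1 \<phi>"
    by (rule fps_ext) (use assms in \<open>simp add: fps_X_mult_nth\<close>)
  then have "fps_X ^ (n - Suc i) * \<phi> ^ i = fps_X ^ (n - 1) * fps_shift 1 \<phi> ^ i" if "i < n" for i
  proof -
    have "n - 1 = (n - Suc i) + i"
      using that by simp
    then have "fps_X ^ (n - 1) * fps_shift 1 \<phi> ^ i
      = fps_X ^ (n - Suc i) * (fps_X * fps_shift 1 \<phi>) ^ i"
      by (simp only: power_add power_mult_distrib mult.assoc)
    then show ?thesis
      using \<open>\<phi> = fps_X * fps_shift 1 \<phi>\<close> by simp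
  qed
  then show ?thesis
    unfolding pow_quot_def sum_distrib_left by (intro sum.cong) auto
qed

lemma pow_quot_nth_eq_0: "\<phi> $ 0 = 0 \<Longrightarrow> Suc m < n \<Longrightarrow> pow_quot \<phi> n $ m = 0"
  by (simp add: pow_quot_eq fps_X_power_mult_nth)

lemma diff_quot:
  fixes u \<phi> :: "'a::field fps"
  assumes "\<phi> $ 0 = 0"
  shows "(u oo \<phi>) - u = (\<phi> - fps_X) * diff_quot u \<phi>"
proof (rule fps_ext)
  fix m
  have pow: "\<phi> ^ n - fps_X ^ n = (\<phi> - fps_X) * pow_quot \<phi> n" for n
    unfolding pow_quot_def by (rule power_diff_sumr2)
  have ext: "diff_quot u \<phi> $ i = (\<Sum>n\<le>Suc m. u $ n * pow_quot \<phi> n $ i)" if "i \<le> m" for i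
    unfolding diff_quot_def fps_nth_Abs_fps
    by (rule sum.mono_neutral_left) (use that assms in \<open>auto simp: pow_quot_nth_eq_0\<close>)
  have "((\<phi> - fps_X) * diff_quot u \<phi>) $ m
    = (\<Sum>i=0..m. \<Sum>n\<le>Suc m. u $ n * ((\<phi> - fps_X) $ (m - i) * pow_quot \<phi> n $ i))"
    unfolding mult.commute[of "\<phi> - fps_X"] fps_mult_nth mult.commute[of "diff_quot u \<phi> $ _"]
    by (intro sum.cong refl)
      (simp add: ext sum_distrib_left mult_ac del: fps_sub_nth sum.atMost_Suc)
  also have "\<dots> = (\<Sum>n\<le>Suc m. u $ n * (\<Sum>i=0..m. pow_quot \<phi> n $ i * (\<phi> - fps_X) $ (m - i)))"
    by (subst sum.swap) (simp add: sum_distrib_left mult_ac del: fps_sub_nth sum.atMost_Suc)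
  also have "\<dots> = (\<Sum>n\<le>Suc m. u $ n * (\<phi> ^ n - fps_X ^ n) $ m)"
    unfolding pow mult.commute[of "\<phi> - fps_X"] fps_mult_nth ..
  also have "\<dots> = (\<Sum>n\<le>m. u $ n * (\<phi> ^ n - fps_X ^ n) $ m)"
    using startsby_zero_power_prefix[OF assms, of "Suc m"] by (simp add: fps_X_power_nth)
  also have "\<dots> = ((u oo \<phi>) - (u oo fps_X)) $ m"
    unfolding fps_sub_nth fps_compose_nth atLeast0AtMost by (simp add: right_diff_distrib sum_subtractf)
  finally show "((u oo \<phi>) - u) $ m = ((\<phi> - fps_X) * diff_quot u \<phi>) $ m"
    by simp
qed

lemma diff_quot_nth_0: "\<phi> $ 0 = 0 \<Longrightarrow> diff_quot u \<phi> $ 0 = u $ 1"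
  by (simp add: diff_quot_def pow_quot_def)

lemma integral_fps_diff_quot:
  assumes "integral_fps u" and "integral_fps \<phi>"
  shows "integral_fps (diff_quot u \<phi>)"
proof -
  have "integral_fps (pow_quot \<phi> n)" for n
    unfolding pow_quot_def
    by (intro integral_fps_sum integral_fps_mult integral_fps_power integral_fps_X assms)
  then have "abs_val (\<Sum>n\<le>Suc m. u $ n * pow_quot \<phi> n $ m) \<le> 1" for m
    using assms(1) unfolding integral_fps_def
    by (intro abs_val_sum_le abs_val_mult_le_1) simp_all
  then show ?thesis
    unfolding integral_fps_def diff_quot_def fps_nth_Abs_fps by blast
qed

text \<open>
  These are the coefficients of the first two terms of the Taylor expansion
  \<open>n X ^ (n - 1) + (n choose 2) X ^ (n - 2) (\<phi> - X) + \<dots>\<close>, where \<open>\<phi> - X = \<phi>\<^sub>3 X\<^sup>3 + \<dots>\<close>.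
\<close>

lemma pow_quot_nth:
  assumes "\<phi> $ 0 = 0" "\<phi> $ 1 = 1" "\<phi> $ 2 = 0" and "n \<ge> 1"
  shows "pow_quot \<phi> n $ (n - 1) = of_nat n"
    and "pow_quot \<phi> n $ n = 0"
    and "pow_quot \<phi> n $ Suc n = of_nat (n choose 2) * \<phi> $ 3"
proof -
  define \<psi> where "\<psi> = fps_shift 1 \<phi>"
  have \<psi>: "\<psi> $ 0 = 1" "\<psi> $ 1 = 0" "\<psi> $ 2 = \<phi> $ 3"
    using assms by (simp_all add: \<psi>_def numeral_2_eq_2 numeral_3_eq_3)
  have pow: "\<psi> ^ i $ 0 = 1 \<and> \<psi> ^ i $ 1 = 0 \<and> \<psi> ^ i $ 2 = of_nat i * \<phi> $ 3" for i
  proof (induction i)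
    case (Suc i)
    then show ?case
      using \<psi> by (simp add: fps_mult_nth numeral_2_eq_2 algebra_simps)
  qed simp
  have *: "pow_quot \<phi> n = fps_X ^ (n - 1) * (\<Sum>i<n. \<psi> ^ i)"
    unfolding \<psi>_def by (rule pow_quot_eq[OF assms(1)])
  show "pow_quot \<phi> n $ (n - 1) = of_nat n"
    unfolding * by (simp add: fps_X_power_mult_nth fps_sum_nth pow)
  have sum_id: "(\<Sum>i<n. i) = n choose 2"
    by (induction n) (simp_all add: numeral_2_eq_2)
  have "n - (n - 1) = 1" "Suc n - (n - 1) = 2"
    using assms(4) by auto
  then show "pow_quot \<phi> n $ n = 0" "pow_quot \<phi> n $ Suc n = of_nat (n choose 2) * \<phi> $ 3"
    unfolding * using assms(4)
    by (simp_all add: fps_X_power_mult_nth fps_sum_nth pow pow[unfolded One_nat_def] sum_id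
        flip: sum_distrib_right of_nat_sum)
qed

lemma diff_quot_nth:
  assumes \<phi>: "\<phi> $ 0 = 0" "\<phi> $ 1 = 1" "\<phi> $ 2 = 0"
    and u: "\<forall>i<k. u $ i = 0" and "k \<ge> 1"
  shows "\<forall>i<k - 1. diff_quot u \<phi> $ i = 0"
    and "diff_quot u \<phi> $ (k - 1) = of_nat k * u $ k"
    and "diff_quot u \<phi> $ k = of_nat (k + 1) * u $ (k + 1)"
    and "diff_quot u \<phi> $ (k + 1) =
      of_nat (k + 2) * u $ (k + 2) + of_nat (k choose 2) * \<phi> $ 3 * u $ k"
proof -
  have *: "diff_quot u \<phi> $ m = (\<Sum>n\<in>{k..Suc m}. u $ n * pow_quot \<phi> n $ m)" for m
    unfolding diff_quot_def fps_nth_Abs_fps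
    by (rule sum.mono_neutral_right) (auto simp: u)
  note pq = pow_quot_nth[OF \<phi>]
  show "\<forall>i<k - 1. diff_quot u \<phi> $ i = 0"
    unfolding * by simp
  have "{k..Suc (k - 1)} = {k}"
    using \<open>k \<ge> 1\<close> by auto
  then show "diff_quot u \<phi> $ (k - 1) = of_nat k * u $ k"
    unfolding * using pq(1)[of k] \<open>k \<ge> 1\<close> by simp
  have "{k..Suc k} = {k, Suc k}"
    by auto
  then show "diff_quot u \<phi> $ k = of_nat (k + 1) * u $ (k + 1)"
    unfolding * using pq(2)[of k] pq(1)[of "Suc k"] \<open>k \<ge> 1\<close> by (simp add: mult.commute)
  have "{k..Suc (Suc k)} = {k, Suc k, Suc (Suc k)}"
    by auto
  then show "diff_quot u \<phi> $ (k + 1) =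
      of_nat (k + 2) * u $ (k + 2) + of_nat (k choose 2) * \<phi> $ 3 * u $ k"
    using *[of "k + 1"] pq(3)[of k] pq(2)[of "Suc k"] pq(1)[of "Suc (Suc k)"] \<open>k \<ge> 1\<close>
    by (simp add: mult.commute)
qed

lemma fps_mult_nth_lowest:
  fixes F G :: "'a::field fps"
  assumes "\<forall>i<a. F $ i = 0" and "\<forall>i<b. G $ i = 0"
  shows "\<forall>i<a + b. (F * G) $ i = 0"
    and "(F * G) $ (a + b) = F $ a * G $ b"
    and "(F * G) $ (a + b + 1) = F $ a * G $ (b + 1) + F $ (a + 1) * G $ b"
    and "(F * G) $ (a + b + 2) =
      F $ a * G $ (b + 2) + F $ (a + 1) * G $ (b + 1) + F $ (a + 2) * G $ b"
proof -
  define F' G' where "F' = fps_shift a F" and "G' = fps_shift b G"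
  have "F = fps_X ^ a * F'" "G = fps_X ^ b * G'"
    using assms by (auto intro!: fps_ext simp: fps_X_power_mult_nth F'_def G'_def)
  then have *: "F * G = fps_X ^ (a + b) * (F' * G')"
    by (simp add: power_add mult_ac)
  have nth: "F' $ i = F $ (a + i)" "G' $ i = G $ (b + i)" for i
    by (simp_all add: F'_def G'_def add.commute)
  show "\<forall>i<a + b. (F * G) $ i = 0"
    "(F * G) $ (a + b) = F $ a * G $ b"
    "(F * G) $ (a + b + 1) = F $ a * G $ (b + 1) + F $ (a + 1) * G $ b"
    "(F * G) $ (a + b + 2) =
      F $ a * G $ (b + 2) + F $ (a + 1) * G $ (b + 1) + F $ (a + 2) * G $ b"
    unfolding * fps_X_power_mult_nth
    by (simp_all add: fps_mult_nth[of F' G'] nth numeral_2_eq_2)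
qed

text \<open>
  The effect of \<open>u \<mapsto> u oo \<phi> - u\<close> on three leading coefficients: to this accuracy the operator is
  \<open>u \<mapsto> (\<phi> - X) u'\<close>, with a correction by the second Taylor term that enters through \<open>\<phi>\<^sub>3\<close> only
  when \<open>\<phi> - X\<close> has order exactly three.
\<close>

lemma compose_minus_nth:
  fixes u \<phi> :: "'a::field fps"
  assumes \<phi>: "\<forall>i<j. (\<phi> - fps_X) $ i = 0" and "j \<ge> 3"
    and u: "\<forall>i<k. u $ i = 0" and "k \<ge> 1"
  defines "d \<equiv> \<lambda>i. (\<phi> - fps_X) $ (j + i)"
  shows "\<forall>i<j + k - 1. ((u oo \<phi>) - u) $ i = 0"
    and "((u oo \<phi>) - u) $ (j + k - 1) = d 0 * (of_nat k * u $ k)"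
    and "((u oo \<phi>) - u) $ (j + k) =
      d 0 * (of_nat (k + 1) * u $ (k + 1)) + d 1 * (of_nat k * u $ k)"
    and "((u oo \<phi>) - u) $ (j + k + 1) =
      d 0 * (of_nat (k + 2) * u $ (k + 2) + of_nat (k choose 2) * \<phi> $ 3 * u $ k)
      + d 1 * (of_nat (k + 1) * u $ (k + 1)) + d 2 * (of_nat k * u $ k)"
proof -
  have low: "\<phi> $ 0 = 0" "\<phi> $ 1 = 1" "\<phi> $ 2 = 0"
    using \<phi>[rule_format, of 0] \<phi>[rule_format, of 1] \<phi>[rule_format, of 2] \<open>j \<ge> 3\<close> by auto
  note S = diff_quot_nth[OF low u \<open>k \<ge> 1\<close>]
  note M = fps_mult_nth_lowest[OF \<phi> S(1), folded diff_quot[OF low(1)]]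
  have eq: "j + (k - 1) = j + k - 1" "k - 1 + 1 = k" "k - 1 + 2 = k + 1"
    "j + k - 1 + 1 = j + k" "j + k - 1 + 2 = j + k + 1"
    using \<open>k \<ge> 1\<close> by auto
  note M' = M[unfolded eq S(2-4)]
  show "\<forall>i<j + k - 1. ((u oo \<phi>) - u) $ i = 0"
    by (rule M'(1))
  show "((u oo \<phi>) - u) $ (j + k - 1) = d 0 * (of_nat k * u $ k)"
    unfolding d_def add_0_right by (rule M'(2))
  show "((u oo \<phi>) - u) $ (j + k) =
      d 0 * (of_nat (k + 1) * u $ (k + 1)) + d 1 * (of_nat k * u $ k)"
    unfolding d_def add_0_right by (rule M'(3))
  show "((u oo \<phi>) - u) $ (j + k + 1) =
      d 0 * (of_nat (k + 2) * u $ (k + 2) + of_nat (k choose 2) * \<phi> $ 3 * u $ k)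
      + d 1 * (of_nat (k + 1) * u $ (k + 1)) + d 2 * (of_nat k * u $ k)"
    unfolding d_def add_0_right by (rule M'(4))
qed

section \<open>Iteration\<close>

lemma fps_iter_0: "fps_iter g 0 = fps_X"
  by (simp add: fps_iter_def)

lemma fps_iter_Suc: "fps_iter g (Suc m) = g oo fps_iter g m"
  by (simp add: fps_iter_def)

lemma fps_iter_1: "fps_iter g 1 = g"
  by (simp add: fps_iter_0 fps_iter_Suc)

lemma fps_iter_nth_0: "g $ 0 = 0 \<Longrightarrow> fps_iter g m $ 0 = 0"
  by (induction m) (simp_all add: fps_iter_0 fps_iter_Suc)

lemma fps_iter_add: "g $ 0 = 0 \<Longrightarrow> fps_iter g (m + n) = fps_iter g m oo fps_iter g n"
  by (induction m) (simp_all add: fps_iter_0 fps_iter_Suc fps_iter_nth_0 fps_compose_assoc)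

lemma fps_iter_commute:
  assumes "f $ 0 = 0"
  shows "f oo fps_iter f m = fps_iter f m oo f"
proof -
  have "f oo fps_iter f m = fps_iter f (m + 1)"
    by (simp add: fps_iter_Suc)
  also have "\<dots> = fps_iter f m oo fps_iter f 1"
    by (rule fps_iter_add[OF assms])
  finally show ?thesis
    by (simp only: fps_iter_1)
qed

lemma fps_iter_mult: "g $ 0 = 0 \<Longrightarrow> fps_iter (fps_iter g m) n = fps_iter g (m * n)"
  by (induction n) (simp_all add: fps_iter_0 fps_iter_Suc fps_iter_add)

lemma integral_fps_iter: "integral_fps g \<Longrightarrow> integral_fps (fps_iter g m)"
  by (induction m) (simp_all add: fps_iter_0 fps_iter_Suc integral_fps_X integral_fps_compose)

lemma fps_iter_nth_1:
  assumes "g $ 0 = 0" and "g $ 1 = 1"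
  shows "fps_iter g m $ 1 = 1"
  using assms by (induction m) (simp_all add: fps_iter_0 fps_iter_Suc fps_compose_nth)

text \<open>
  Newton's forward difference formula for the operator \<open>u \<mapsto> u oo \<phi> - u\<close>.
\<close>

lemma fps_compose_iter_eq_sum:
  fixes u \<phi> :: "'a::field fps"
  assumes "\<phi> $ 0 = 0"
  shows "u oo fps_iter \<phi> m = (\<Sum>k\<le>m. of_nat (m choose k) * ((\<lambda>w. (w oo \<phi>) - w) ^^ k) u)"
proof (induction m arbitrary: u)
  case (Suc m)
  let ?\<Delta> = "\<lambda>w. (w oo \<phi>) - w"
  have shift: "(?\<Delta> ^^ k) (?\<Delta> u) = (?\<Delta> ^^ Suc k) u" for k
    by (simp only: funpow_Suc_right o_apply)
  have add: "(?\<Delta> ^^ k) (v + w) = (?\<Delta> ^^ k) v + (?\<Delta> ^^ k) w" for k v w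
    by (induction k) (simp_all add: fps_compose_add_distrib)
  have "u oo fps_iter \<phi> (Suc m) = (u + ?\<Delta> u) oo fps_iter \<phi> m"
    by (simp add: fps_iter_Suc fps_compose_assoc assms fps_iter_nth_0)
  also have "\<dots> = (\<Sum>k\<le>m. of_nat (m choose k) * (?\<Delta> ^^ k) u)
      + (\<Sum>k\<le>m. of_nat (m choose k) * (?\<Delta> ^^ Suc k) u)"
    unfolding Suc.IH add shift by (simp only: distrib_left sum.distrib)
  also have "(\<Sum>k\<le>m. of_nat (m choose k) * (?\<Delta> ^^ k) u)
      = u + (\<Sum>k\<le>m. of_nat (m choose Suc k) * (?\<Delta> ^^ Suc k) u)"
  proof -
    have "(\<Sum>k\<le>m. of_nat (m choose k) * (?\<Delta> ^^ k) u)
        = (\<Sum>k\<le>Suc m. of_nat (m choose k) * (?\<Delta> ^^ k) u)"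
      by (simp add: binomial_eq_0 del: funpow.simps)
    also have "\<dots> = u + (\<Sum>k\<le>m. of_nat (m choose Suc k) * (?\<Delta> ^^ Suc k) u)"
      by (subst sum.atMost_Suc_shift) (simp del: sum.atMost_Suc funpow.simps)
    finally show ?thesis .
  qed
  also have "u + (\<Sum>k\<le>m. of_nat (m choose Suc k) * (?\<Delta> ^^ Suc k) u)
      + (\<Sum>k\<le>m. of_nat (m choose k) * (?\<Delta> ^^ Suc k) u)
    = u + (\<Sum>k\<le>m. of_nat (Suc m choose Suc k) * (?\<Delta> ^^ Suc k) u)"
    by (simp add: sum.distrib algebra_simps del: funpow.simps)
  also have "\<dots> = (\<Sum>k\<le>Suc m. of_nat (Suc m choose k) * (?\<Delta> ^^ k) u)"
    by (subst sum.atMost_Suc_shift) (simp del: sum.atMost_Suc funpow.simps binomial_Suc_Suc)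
  finally show ?case .
qed (simp add: fps_iter_0)

lemma fps_iter_CHAR_minus_X:
  fixes \<phi> :: "'a::field fps"
  assumes "\<phi> $ 0 = 0" and p: "prime p" "CHAR('a) = p"
  shows "fps_iter \<phi> p - fps_X = ((\<lambda>w. (w oo \<phi>) - w) ^^ p) fps_X"
proof -
  let ?\<Delta> = "\<lambda>w. (w oo \<phi>) - w"
  have "0 < p"
    using p prime_gt_0_nat by blast
  have "fps_iter \<phi> p = (\<Sum>k\<le>p. of_nat (p choose k) * (?\<Delta> ^^ k) fps_X)"
    using fps_compose_iter_eq_sum[OF assms(1), of fps_X p] fps_iter_nth_0[OF assms(1)] by simp
  also have "\<dots> = (\<Sum>k\<in>{0, p}. of_nat (p choose k) * (?\<Delta> ^^ k) fps_X)"
  proof (rule sum.mono_neutral_right)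
    show "\<forall>k\<in>{..p} - {0, p}. of_nat (p choose k) * (?\<Delta> ^^ k) fps_X = 0"
    proof
      fix k assume "k \<in> {..p} - {0, p}"
      then have "p dvd p choose k"
        using p(1) by (intro dvd_choose_prime) auto
      then have "of_nat (p choose k) = (0 :: 'a fps)"
        using p(2) by (simp add: of_nat_eq_0_iff_char_dvd)
      then show "of_nat (p choose k) * (?\<Delta> ^^ k) fps_X = 0"
        by simp
    qed
  qed auto
  finally show ?thesis
    using \<open>0 < p\<close> by simp
qed

section \<open>Leading coefficients of the iterates of order a power of the characteristic\<close>

definition odd_prod :: "nat \<Rightarrow> nat"
  where "odd_prod m = (\<Prod>i<m. 2 * i + 1)"

definition even_prod :: "nat \<Rightarrow> nat"
  where "even_prod m = (\<Prod>i<m. 2 * i + 2)"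

text \<open>
  Up to normalization and smaller terms, the three leading coefficients of the \<open>m\<close>-th iterate of
  \<open>u \<mapsto> u oo \<phi> - u\<close> on \<open>X\<close> are \<open>\<alpha>\<^sub>m\<close>, \<open>\<beta>\<^sub>m\<close>, \<open>\<gamma>\<^sub>m\<close> with \<open>\<alpha>\<^sub>m\<^sub>+\<^sub>1 = (2 m + 1) \<alpha>\<^sub>m\<close>,
  \<open>\<beta>\<^sub>m\<^sub>+\<^sub>1 = (2 m + 1) \<alpha>\<^sub>m + (2 m + 2) \<beta>\<^sub>m\<close> and \<open>\<gamma>\<^sub>m\<^sub>+\<^sub>1 = (2 m + 2) \<beta>\<^sub>m + (2 m + 3) \<gamma>\<^sub>m\<close>.  The solution is
  \<open>\<alpha>\<^sub>m = odd_prod m\<close>, \<open>\<beta>\<^sub>m = odd_prod (m + 1) - even_prod m\<close> and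
  \<open>\<gamma>\<^sub>m = third_coeff m - even_prod (m + 1)\<close>.
\<close>

primrec third_coeff :: "nat \<Rightarrow> nat" where
  "third_coeff 0 = 2"
| "third_coeff (Suc m) = (2 * m + 2) * odd_prod (Suc m) + (2 * m + 3) * third_coeff m"

lemma odd_prod_Suc: "odd_prod (Suc m) = (2 * m + 1) * odd_prod m"
  by (simp add: odd_prod_def)

lemma even_prod_Suc: "even_prod (Suc m) = (2 * m + 2) * even_prod m"
  by (simp add: even_prod_def)

lemma prime_dvd_odd_prod:
  assumes "prime p" and "odd p" and "p < 2 * m"
  shows "p dvd odd_prod m"
proof -
  obtain i where "p = 2 * i + 1"
    using assms(2) by (rule oddE)
  then show ?thesis
    unfolding odd_prod_def using assms(3) dvd_prodI[of "{..<m}" i "\<lambda>i. 2 * i + 1"] by auto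
qed

lemma prime_dvd_even_prod:
  assumes "prime p" and "p \<le> m"
  shows "p dvd even_prod m"
proof -
  have "0 < p"
    using assms(1) by (rule prime_gt_0_nat)
  then have "2 * (p - 1) + 2 = 2 * p" "p - 1 < m"
    using assms(2) by auto
  moreover have "2 * (p - 1) + 2 dvd even_prod m" if "p - 1 < m"
    unfolding even_prod_def using that dvd_prodI[of "{..<m}" "p - 1" "\<lambda>i. 2 * i + 2"] by simp
  ultimately show ?thesis
    using dvd_trans[OF dvd_triv_right[of p 2]] by simp
qed

text \<open>
  At \<open>2 * m + 3 = p\<close> the recursion forgets the past and restarts from a product of positive
  integers below \<open>p\<close>.  From then on \<open>odd_prod\<close> vanishes modulo \<open>p\<close>, and the odd factors
  \<open>2 * m + 3\<close> lie strictly between \<open>p\<close> and \<open>3 * p\<close>.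
\<close>

lemma prime_not_dvd_third_coeff:
  assumes "prime p" and "odd p"
  shows "\<not> p dvd third_coeff p"
proof -
  obtain h where h: "p = 2 * h + 1"
    using assms(2) by (rule oddE)
  have "h \<noteq> 0"
    using assms(1) h by (metis add_0 mult_0_right not_prime_1)
  then obtain h' where h': "h = Suc h'"
    by (cases h) auto
  have "\<not> p dvd third_coeff (h + i)" if "h + i \<le> p" for i
    using that
  proof (induction i)
    case 0
    have "\<not> p dvd (2 * h' + 2) * odd_prod h"
    proof
      assume "p dvd (2 * h' + 2) * odd_prod h"
      then consider "p dvd 2 * h' + 2" | i where "i < h" "p dvd 2 * i + 1"
        unfolding odd_prod_def prime_dvd_mult_iff[OF assms(1)]
          prime_dvd_prod_iff[OF finite_lessThan assms(1)] by blast
      then show False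
        using h h' by cases (auto dest!: dvd_imp_le)
    qed
    moreover have "third_coeff h = (2 * h' + 2) * odd_prod h + p * third_coeff h'"
      using h h' by (simp add: add_mult_distrib)
    ultimately show ?case
      by (metis add_0_right dvd_add_times_triv_right_iff mult.commute)
  next
    case (Suc i)
    have "\<not> p dvd 2 * (h + i) + 3"
    proof
      assume "p dvd 2 * (h + i) + 3"
      then obtain q where q: "2 * (h + i) + 3 = p * q"
        by (rule dvdE)
      have "p * 1 < p * q" and "p * q < p * 3"
        unfolding q[symmetric] using h \<open>h \<noteq> 0\<close> Suc.prems by simp_all
      then have "q = 2"
        by simp
      then show False
        using q by presburger
    qed
    moreover have "p dvd odd_prod (Suc (h + i))"
      using assms h by (intro prime_dvd_odd_prod) auto
    ultimately show ?case
      using Suc assms(1) by (simp add: prime_dvd_mult_iff dvd_add_right_iff)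
  qed
  moreover have "h + (p - h) = p"
    using h by simp
  ultimately show ?thesis
    by (metis order_refl)
qed

text \<open>
  The iterate of order \<open>p\<close> is obtained by applying \<open>u \<mapsto> u oo \<phi> - u\<close> to \<open>X\<close> exactly \<open>p\<close> times.
  On the three leading coefficients this operator acts through linear recursions with integer
  coefficients, because \<open>j\<close> is congruent to three modulo the characteristic.  Modulo \<open>p\<close>
  the first two solutions vanish after \<open>p\<close> steps, so that the order increases by two.  The third
  coefficient is dominated by the term with \<open>a\<^sub>3\<^sup>2\<close>, since the remaining ones
  contain a further factor \<open>a\<^sub>2\<close>.
\<close>

lemma iter_CHAR_leading_coeff:
  fixes \<phi> :: "'k::ultrametric_field fps"
  assumes p: "prime p" "odd p" "CHAR('k) = p"
    and \<phi>: "\<forall>i<j. (\<phi> - fps_X) $ i = 0" "integral_fps \<phi>"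
    and j: "j \<ge> 3" "of_nat j = (3 :: 'k)"
    and a: "a\<^sub>2 \<noteq> 0" "abs_val a\<^sub>2 < 1" "abs_val a\<^sub>3 = 1"
    and d1: "a\<^sub>2 * (\<phi> - fps_X) $ (j + 1) = (\<phi> - fps_X) $ j * a\<^sub>3"
    and d2: "a\<^sub>2 * (\<phi> - fps_X) $ (j + 2) = (\<phi> - fps_X) $ j * s" "abs_val s \<le> 1"
  shows "\<forall>i<p * (j - 1) + 3. (fps_iter \<phi> p - fps_X) $ i = 0"
    and "abs_val a\<^sub>2 ^ 2 * abs_val ((fps_iter \<phi> p - fps_X) $ (p * (j - 1) + 3))
      = abs_val ((\<phi> - fps_X) $ j) ^ p"
proof -
  define c where "c = (\<phi> - fps_X) $ j"
  define u where "u m = ((\<lambda>w. (w oo \<phi>) - w) ^^ m) fps_X" for m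
  define k where "k m = m * (j - 1) + 1" for m
  have low: "\<phi> $ 0 = 0"
    using \<phi>(1)[rule_format, of 0] j by simp
  have of_nat_k: "(of_nat (k m) :: 'k) = of_nat (2 * m + 1)" for m
    using j unfolding k_def by (simp add: of_nat_diff)
  have k_Suc: "k (Suc m) + 1 - 1 = k (Suc m)" "j + k m = k (Suc m) + 1"
      "k (Suc m) + 1 + 1 = k (Suc m) + 2" for m
  proof -
    obtain q where "j = Suc q"
      using j(1) by (cases j) auto
    then show "k (Suc m) + 1 - 1 = k (Suc m)" "j + k m = k (Suc m) + 1"
      "k (Suc m) + 1 + 1 = k (Suc m) + 2"
      by (simp_all add: k_def)
  qed
  have \<phi>3: "abs_val (\<phi> $ 3) \<le> 1"
    using \<phi>(2) by (simp add: integral_fps_def)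
  \<comment> \<open>The powers of \<open>a\<^sub>2\<close> clear denominators: the three leading coefficients of \<open>\<phi> - X\<close> are
    \<open>c\<close>, \<open>c * a\<^sub>3 / a\<^sub>2\<close> and \<open>c * s / a\<^sub>2\<close>.\<close>
  have step: "(\<forall>i<k (Suc m). u (Suc m) $ i = 0)
    \<and> u (Suc m) $ k (Suc m) = c ^ Suc m * of_nat (odd_prod (Suc m))
    \<and> a\<^sub>2 * u (Suc m) $ (k (Suc m) + 1) = c ^ Suc m * a\<^sub>3 *
        (of_nat (odd_prod (Suc (Suc m))) - of_nat (even_prod (Suc m)))
    \<and> (\<exists>e. abs_val e \<le> 1 \<and> a\<^sub>2 ^ 2 * u (Suc m) $ (k (Suc m) + 2) = c ^ Suc m *
        (a\<^sub>3 ^ 2 * (of_nat (third_coeff (Suc m)) - of_nat (even_prod (Suc (Suc m)))) + a\<^sub>2 * e))" for m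
  proof (induction m)
    case 0
    have u1: "u (Suc 0) = \<phi> - fps_X"
      by (simp add: u_def low)
    have k1: "k (Suc 0) = j"
      using j by (simp add: k_def)
    have ev: "odd_prod 0 = 1" "even_prod 0 = 1"
      by (simp_all add: odd_prod_def even_prod_def)
    have "a\<^sub>2 ^ 2 * u (Suc 0) $ (j + 2) = a\<^sub>2 * (a\<^sub>2 * (\<phi> - fps_X) $ (j + 2))"
      unfolding u1 by (simp add: power2_eq_square)
    also have "\<dots> = c * (a\<^sub>2 * s)"
      unfolding d2 c_def by (rule mult.left_commute)
    finally have third: "a\<^sub>2 ^ 2 * u (Suc 0) $ (j + 2) = c * (a\<^sub>2 * s)" .
    show ?case
      unfolding k1
    proof (intro conjI exI[of _ s])
      show "a\<^sub>2 * u (Suc 0) $ (j + 1) = c ^ Suc 0 * a\<^sub>3 *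
        (of_nat (odd_prod (Suc (Suc 0))) - of_nat (even_prod (Suc 0)))"
        unfolding u1 d1 by (simp add: c_def odd_prod_Suc even_prod_Suc ev)
      show "a\<^sub>2 ^ 2 * u (Suc 0) $ (j + 2) = c ^ Suc 0 *
        (a\<^sub>3 ^ 2 * (of_nat (third_coeff (Suc 0)) - of_nat (even_prod (Suc (Suc 0)))) + a\<^sub>2 * s)"
        unfolding third by (simp add: odd_prod_Suc even_prod_Suc ev)
    qed (use \<phi>(1) d2(2) in \<open>simp_all add: u1 c_def odd_prod_Suc ev\<close>)
  next
    case (Suc m)
    define n where "n = Suc m"
    note IH = Suc.IH[folded n_def]
    obtain e where e: "abs_val e \<le> 1" and
      third: "a\<^sub>2 ^ 2 * u n $ (k n + 2) = c ^ n *
        (a\<^sub>3 ^ 2 * (of_nat (third_coeff n) - of_nat (even_prod (Suc n))) + a\<^sub>2 * e)"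
      using IH by blast
    have first: "u n $ k n = c ^ n * of_nat (odd_prod n)"
      and second: "a\<^sub>2 * u n $ (k n + 1) = c ^ n * a\<^sub>3 *
        (of_nat (odd_prod (Suc n)) - of_nat (even_prod n))"
      using IH by blast+
    have "k n \<ge> 1"
      by (simp add: k_def)
    have u_Suc: "(u n oo \<phi>) - u n = u (Suc n)"
      by (simp add: u_def)
    note C = compose_minus_nth[OF \<phi>(1) j(1) IH[THEN conjunct1] \<open>k n \<ge> 1\<close>,
        unfolded u_Suc k_Suc add_0_right, folded c_def]
    define e' where "e' = of_nat (k n + 2) * e
      + of_nat (k n choose 2) * \<phi> $ 3 * a\<^sub>2 * of_nat (odd_prod n) + s * of_nat (k n) * of_nat (odd_prod n)"
    have "abs_val e' \<le> 1"
      unfolding e'_def using e d2(2) \<phi>3 a(2)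
      by (intro abs_val_add_le abs_val_mult_le_1 abs_val_of_nat_le_1) auto
    moreover have "a\<^sub>2 ^ 2 * u (Suc n) $ (k (Suc n) + 2) = c ^ Suc n *
        (a\<^sub>3 ^ 2 * (of_nat (third_coeff (Suc n)) - of_nat (even_prod (Suc (Suc n)))) + a\<^sub>2 * e')"
    proof -
      have "a\<^sub>2 ^ 2 * u (Suc n) $ (k (Suc n) + 2) =
        c * (of_nat (k n + 2) * (a\<^sub>2 ^ 2 * u n $ (k n + 2))
          + a\<^sub>2 ^ 2 * of_nat (k n choose 2) * \<phi> $ 3 * u n $ k n)
        + (a\<^sub>2 * (\<phi> - fps_X) $ (j + 1)) * of_nat (k n + 1) * (a\<^sub>2 * u n $ (k n + 1))
        + a\<^sub>2 * (a\<^sub>2 * (\<phi> - fps_X) $ (j + 2)) * of_nat (k n) * u n $ k n"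
        unfolding C(4) by (simp only: power2_eq_square distrib_left mult_ac)
      also have "\<dots> = c ^ Suc n * (a\<^sub>3 ^ 2 * (of_nat (k n + 2) * (of_nat (third_coeff n)
            - of_nat (even_prod (Suc n))) + of_nat (k n + 1) *
            (of_nat (odd_prod (Suc n)) - of_nat (even_prod n))) + a\<^sub>2 * e')"
        unfolding d1 d2(1) second third first e'_def c_def[symmetric]
        by (simp add: power2_eq_square algebra_simps)
      also have "of_nat (k n + 2) * (of_nat (third_coeff n) - of_nat (even_prod (Suc n)))
          + of_nat (k n + 1) * (of_nat (odd_prod (Suc n)) - of_nat (even_prod n))
        = (of_nat (third_coeff (Suc n)) - of_nat (even_prod (Suc (Suc n))) :: 'k)"
        unfolding of_nat_add of_nat_k
        by (simp add: even_prod_Suc[of "Suc n"] even_prod_Suc[of n] algebra_simps)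
      finally show ?thesis .
    qed
    moreover have "u (Suc n) $ k (Suc n) = c ^ Suc n * of_nat (odd_prod (Suc n))"
      unfolding C(2) first odd_prod_Suc of_nat_k of_nat_mult by (simp add: mult_ac)
    moreover have "a\<^sub>2 * u (Suc n) $ (k (Suc n) + 1) = c ^ Suc n * a\<^sub>3 *
        (of_nat (odd_prod (Suc (Suc n))) - of_nat (even_prod (Suc n)))"
    proof -
      have "a\<^sub>2 * u (Suc n) $ (k (Suc n) + 1) = c * (of_nat (k n + 1) * (a\<^sub>2 * u n $ (k n + 1)))
        + (a\<^sub>2 * (\<phi> - fps_X) $ (j + 1)) * (of_nat (k n) * u n $ k n)"
        unfolding C(3) by (simp only: distrib_left mult_ac)
      also have "\<dots> = c ^ Suc n * a\<^sub>3 * (of_nat (k n + 1) * (of_nat (odd_prod (Suc n))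
        - of_nat (even_prod n)) + of_nat (k n) * of_nat (odd_prod n))"
        unfolding d1 second first c_def[symmetric] by (simp add: algebra_simps)
      also have "of_nat (k n + 1) * (of_nat (odd_prod (Suc n)) - of_nat (even_prod n))
          + of_nat (k n) * of_nat (odd_prod n)
        = (of_nat (odd_prod (Suc (Suc n))) - of_nat (even_prod (Suc n)) :: 'k)"
        unfolding of_nat_add of_nat_k
        by (simp add: even_prod_Suc odd_prod_Suc algebra_simps)
      finally show ?thesis .
    qed
    ultimately show ?case
      unfolding n_def[symmetric] using C(1) by blast
  qed
  have "p \<noteq> 0"
    using p(1) by auto
  then obtain m where m: "p = Suc m"
    by (cases p) auto
  have dvd: "(of_nat n :: 'k) = 0" if "p dvd n" for n
    using that p(3) by (simp add: of_nat_eq_0_iff_char_dvd)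
  have "0 < p"
    using \<open>p \<noteq> 0\<close> by simp
  then have "p dvd odd_prod p" "p dvd odd_prod (Suc p)" "p dvd even_prod p" "p dvd even_prod (Suc p)"
    using p(1,2) by (simp_all add: prime_dvd_odd_prod prime_dvd_even_prod)
  note zero = this[THEN dvd]
  obtain e where e: "abs_val e \<le> 1"
    and up: "\<forall>i<k p. u p $ i = 0" "u p $ k p = 0" "a\<^sub>2 * u p $ (k p + 1) = 0"
      "a\<^sub>2 ^ 2 * u p $ (k p + 2) = c ^ p * (a\<^sub>3 ^ 2 * of_nat (third_coeff p) + a\<^sub>2 * e)"
    using step[of m, folded m] unfolding zero by auto
  have D: "fps_iter \<phi> p - fps_X = u p"
    unfolding u_def by (rule fps_iter_CHAR_minus_X[OF low p(1) p(3)])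
  show "\<forall>i<p * (j - 1) + 3. (fps_iter \<phi> p - fps_X) $ i = 0"
  proof (intro allI impI)
    fix i assume "i < p * (j - 1) + 3"
    then consider "i < k p" | "i = k p" | "i = k p + 1"
      unfolding k_def by linarith
    then show "(fps_iter \<phi> p - fps_X) $ i = 0"
      unfolding D using up a(1) by cases auto
  qed
  have "abs_val (a\<^sub>3 ^ 2 * of_nat (third_coeff p)) = 1"
    using a(3) prime_not_dvd_third_coeff[OF p(1,2)] p(1,3)
    by (simp add: abs_val_mult abs_val_power abs_val_of_nat_eq_1)
  moreover have "abs_val (a\<^sub>2 * e) < 1"
    using a(2) e abs_val_nonneg[of a\<^sub>2] abs_val_nonneg[of e]
    by (auto simp: abs_val_mult intro: le_less_trans[OF mult_right_le_one_le])
  ultimately have "abs_val (a\<^sub>3 ^ 2 * of_nat (third_coeff p) + a\<^sub>2 * e) = 1"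
    by (simp add: abs_val_add_eq)
  then have "abs_val (a\<^sub>2 ^ 2 * u p $ (k p + 2)) = abs_val c ^ p"
    unfolding up(4) by (simp add: abs_val_mult abs_val_power)
  moreover have "k p + 2 = p * (j - 1) + 3"
    by (simp add: k_def)
  ultimately show "abs_val a\<^sub>2 ^ 2 * abs_val ((fps_iter \<phi> p - fps_X) $ (p * (j - 1) + 3))
      = abs_val ((\<phi> - fps_X) $ j) ^ p"
    unfolding D c_def[symmetric] by (simp only: abs_val_mult abs_val_power)
qed

text \<open>
  With \<open>v = f - X\<close> and \<open>w = \<phi> - X\<close>, commutation says \<open>w oo f - w = v oo \<phi> - v\<close>, that is
  \<open>w' v = v' w\<close> up to second Taylor terms, so \<open>w / v\<close> has vanishing derivative to leading order.
  As the orders of \<open>v\<close> and \<open>w\<close> are congruent modulo the characteristic, the lowest coefficients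
  in this equation cancel, and the next two determine \<open>d 1\<close> and \<open>d 2\<close> in terms of \<open>d 0\<close>.
\<close>

lemma commuting_coeffs:
  fixes f \<phi> :: "'a::field fps"
  assumes f: "f $ 0 = 0" "f $ 1 = 1" "f $ 2 = 0"
    and \<phi>: "\<forall>i<j. (\<phi> - fps_X) $ i = 0" and j: "j \<ge> 3" "of_nat j = (3 :: 'a)"
    and commute: "f oo \<phi> = \<phi> oo f"
  defines "d \<equiv> \<lambda>i. (\<phi> - fps_X) $ (j + i)"
  shows "f $ 3 * d 1 = d 0 * f $ 4"
    and "2 * (f $ 3 * d 2) =
      d 0 * (2 * f $ 5 + 3 * \<phi> $ 3 * f $ 3 - of_nat (j choose 2) * (f $ 3) ^ 2)"
proof -
  define v w where "v = f - fps_X" and "w = \<phi> - fps_X"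
  have v: "\<forall>i<3. v $ i = 0" "v $ 3 = f $ 3" "v $ 4 = f $ 4" "v $ 5 = f $ 5"
    using f by (auto simp: v_def less_Suc_eq numeral_3_eq_3 numeral_2_eq_2)
  have "\<phi> $ 0 = 0"
    using \<phi>[rule_format, of 0] j by simp
  then have eq: "(w oo f) - w = (v oo \<phi>) - v"
    using f(1) commute by (simp add: v_def w_def fps_compose_sub_distrib)
  note L = compose_minus_nth[OF v(1)[unfolded v_def] order_refl, of j w]
  note R = compose_minus_nth[OF \<phi> j(1) v(1)]
  have w: "\<forall>i<j. w $ i = 0" "1 \<le> j"
    using \<phi> j unfolding w_def by auto
  have wd: "w $ j = d 0" "w $ (j + 1) = d 1" "w $ (j + 2) = d 2"
    by (simp_all add: w_def d_def)
  have nat: "of_nat (j + 1) = (4 :: 'a)" "of_nat (j + 2) = (5 :: 'a)"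
    using j(2) by simp_all
  have choose: "of_nat (3 choose 2) = (3 :: 'a)"
    by (simp add: choose_two)
  have "((w oo f) - w) $ (3 + j) = f $ 3 * (4 * d 1) + f $ 4 * (3 * d 0)"
    using L(3)[OF w] v wd nat j(2) unfolding v_def by simp
  moreover have "((v oo \<phi>) - v) $ (j + 3) = d 0 * (4 * f $ 4) + d 1 * (3 * f $ 3)"
    using R(3) v unfolding d_def by simp
  ultimately show *: "f $ 3 * d 1 = d 0 * f $ 4"
    unfolding eq add.commute[of 3 j] by (simp add: algebra_simps)
  have "((w oo f) - w) $ (3 + j + 1) = f $ 3 * (5 * d 2 + of_nat (j choose 2) * f $ 3 * d 0)
      + f $ 4 * (4 * d 1) + f $ 5 * (3 * d 0)"
    using L(4)[OF w] v wd nat j(2) unfolding v_def by simp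
  moreover have "((v oo \<phi>) - v) $ (j + 3 + 1) = d 0 * (5 * f $ 5 + 3 * \<phi> $ 3 * f $ 3)
      + d 1 * (4 * f $ 4) + d 2 * (3 * f $ 3)"
    using R(4) v choose unfolding d_def by simp
  ultimately show "2 * (f $ 3 * d 2) =
      d 0 * (2 * f $ 5 + 3 * \<phi> $ 3 * f $ 3 - of_nat (j choose 2) * (f $ 3) ^ 2)"
    unfolding eq add.commute[of 3 j] by (simp add: algebra_simps power2_eq_square)
qed

context
  fixes f :: "'k::ultrametric_field fps" and p :: nat
  assumes f: "integral_fps f" "f $ 0 = 0" "f $ 1 = 1" "f $ 2 = 0"
    and f3: "f $ 3 \<noteq> 0" "abs_val (f $ 3) < 1" and f4: "abs_val (f $ 4) = 1"
    and p: "prime p" "p \<ge> 5" "CHAR('k) = p"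
begin

lemma odd_p: "odd p"
  using p prime_odd_nat by fastforce

text \<open>
  The orders \<open>j n\<close> are those of a \<open>2\<close>-ramified series.  They are all congruent to three modulo \<open>p\<close>,
  and every iterate commutes with \<open>f\<close>; hence the passage from \<open>n\<close> to \<open>Suc n\<close> obeys the same
  formula for all \<open>n\<close>.
\<close>

lemma iter_p_power_leading_coeff:
  defines "j \<equiv> \<lambda>n. 2 * (\<Sum>i\<le>n. p ^ i) + 1"
  shows "\<forall>i<j n. (fps_iter f (p ^ n) - fps_X) $ i = 0"
    and "abs_val (f $ 3) ^ 2 * abs_val ((fps_iter f (p ^ Suc n) - fps_X) $ j (Suc n))
      = abs_val ((fps_iter f (p ^ n) - fps_X) $ j n) ^ p"
proof -
  have j_Suc: "p * (j n - 1) + 3 = j (Suc n)" for n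
  proof -
    have "(\<Sum>i\<le>Suc n. p ^ i) = 1 + p * (\<Sum>i\<le>n. p ^ i)"
      by (subst sum.atMost_Suc_shift) (simp add: sum_distrib_left)
    then show ?thesis
      unfolding j_def by simp
  qed
  have j_ge: "j n \<ge> 3" for n
  proof -
    have "(\<Sum>i\<in>{0}. p ^ i) \<le> (\<Sum>i\<le>n. p ^ i)"
      by (rule sum_mono2) auto
    then show ?thesis
      unfolding j_def by simp
  qed
  have j_mod: "of_nat (j n) = (3 :: 'k)" for n
  proof (cases n)
    case (Suc m)
    then have "of_nat (j n) = (of_nat (p * (j m - 1) + 3) :: 'k)"
      by (simp only: j_Suc)
    also have "\<dots> = of_nat CHAR('k) * of_nat (j m - 1) + 3"
      using p(3) by simp
    finally show ?thesis
      by simp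
  qed (simp add: j_def)
  have "\<not> p dvd 2"
    using p(2) by (auto dest: dvd_imp_le)
  then have two: "abs_val (2 :: 'k) = 1"
    using abs_val_of_nat_eq_1[of 2, where ?'k='k] p(1,3) by simp
  then have "(2 :: 'k) \<noteq> 0"
    by auto
  have step: "(\<forall>i<j (Suc n). (fps_iter f (p ^ Suc n) - fps_X) $ i = 0) \<and>
      abs_val (f $ 3) ^ 2 * abs_val ((fps_iter f (p ^ Suc n) - fps_X) $ j (Suc n))
      = abs_val ((fps_iter f (p ^ n) - fps_X) $ j n) ^ p"
    if low: "\<forall>i<j n. (fps_iter f (p ^ n) - fps_X) $ i = 0" for n
  proof -
    define \<phi> where "\<phi> = fps_iter f (p ^ n)"
    define s where "s = (2 * f $ 5 + 3 * \<phi> $ 3 * f $ 3 - of_nat (j n choose 2) * (f $ 3) ^ 2) / 2"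
    have int: "integral_fps \<phi>"
      unfolding \<phi>_def using f(1) by (rule integral_fps_iter)
    have coeff: "abs_val (f $ i) \<le> 1" "abs_val (\<phi> $ i) \<le> 1" for i
      using f(1) int unfolding integral_fps_def by blast+
    have three: "abs_val (3 :: 'k) \<le> 1"
      using abs_val_of_nat_le_1[of 3, where ?'k='k] by simp
    have "abs_val (2 * f $ 5 + 3 * \<phi> $ 3 * f $ 3 - of_nat (j n choose 2) * (f $ 3) ^ 2) \<le> 1"
      unfolding power2_eq_square
      by (intro abs_val_add_le abs_val_diff_le abs_val_mult_le_1 abs_val_of_nat_le_1 coeff three
          eq_refl[OF two])
    then have s: "abs_val s \<le> 1"
      unfolding s_def divide_inverse abs_val_mult[of _ "inverse 2"] abs_val_inverse two by simp
    note C = commuting_coeffs[OF f(2-4) low j_ge j_mod fps_iter_commute[OF f(2)], folded \<phi>_def]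
    have d2: "f $ 3 * (\<phi> - fps_X) $ (j n + 2) = (\<phi> - fps_X) $ j n * s"
      using C(2) \<open>(2 :: 'k) \<noteq> 0\<close> unfolding s_def times_divide_eq_right
      by (simp only: nonzero_eq_divide_eq mult.commute[of _ 2] not_False_eq_True add_0_right)
    have iter: "fps_iter \<phi> p = fps_iter f (p ^ Suc n)"
      unfolding \<phi>_def using f(2) by (simp add: fps_iter_mult mult.commute)
    have d1: "f $ 3 * (\<phi> - fps_X) $ (j n + 1) = (\<phi> - fps_X) $ j n * f $ 4"
      using C(1) by simp
    note L = iter_CHAR_leading_coeff[OF p(1) odd_p p(3) low[folded \<phi>_def] int j_ge j_mod
        f3 f4 d1 d2 s, unfolded iter j_Suc]
    then show ?thesis
      unfolding \<phi>_def by blast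
  qed
  show *: "\<forall>i<j n. (fps_iter f (p ^ n) - fps_X) $ i = 0" for n
  proof (induction n)
    case 0
    have "j 0 = 3" "fps_iter f (p ^ 0) = f"
      by (simp_all add: j_def fps_iter_1[unfolded One_nat_def])
    then show ?case
      using f by (auto simp: less_Suc_eq numeral_3_eq_3 numeral_2_eq_2)
  qed (use step in blast)
  show "abs_val (f $ 3) ^ 2 * abs_val ((fps_iter f (p ^ Suc n) - fps_X) $ j (Suc n))
      = abs_val ((fps_iter f (p ^ n) - fps_X) $ j n) ^ p"
    using step[OF *] by blast
qed

text \<open>
  The recursion \<open>\<bar>f\<^sub>3\<bar>\<^sup>2 d\<^sub>n\<^sub>+\<^sub>1 = d\<^sub>n ^ p\<close> raises the ratio of consecutive terms to the \<open>p\<close>-th power, and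
  it gives \<open>\<bar>f\<^sub>3\<bar> ^ (p - 3)\<close> for the first ratio.
\<close>

lemma iter_p_power_leading_coeff_ratio:
  defines "j \<equiv> \<lambda>n. 2 * (\<Sum>i\<le>n. p ^ i) + 1"
  defines "d \<equiv> \<lambda>n. abs_val ((fps_iter f (p ^ n) - fps_X) $ j n)"
  shows "d n > 0" and "d (Suc n) = d n * (abs_val (f $ 3) ^ (p - 3)) ^ p ^ n"
proof -
  define A where "A = abs_val (f $ 3)"
  have A: "A > 0"
    unfolding A_def using f3(1) by (metis abs_val_eq_0_iff abs_val_nonneg less_eq_real_def)
  have d_Suc: "A ^ 2 * d (Suc n) = d n ^ p" for n
    unfolding A_def d_def j_def by (rule iter_p_power_leading_coeff(2))
  have d0: "d 0 = A"
    by (simp add: d_def j_def A_def fps_iter_1[unfolded One_nat_def])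
  have "d (Suc n) = d n * (A ^ (p - 3)) ^ p ^ n" for n
  proof (induction n)
    case 0
    have "A ^ 2 * d (Suc 0) = A ^ (2 + 1 + (p - 3))"
      unfolding d_Suc d0 using p(2) by simp
    also have "\<dots> = A ^ 2 * (d 0 * (A ^ (p - 3)) ^ p ^ 0)"
      by (simp only: power_add d0 power_0 power_one_right mult.assoc)
    finally show ?case
      using A by simp
  next
    case (Suc n)
    have "A ^ 2 * d (Suc (Suc n)) = (d n * (A ^ (p - 3)) ^ p ^ n) ^ p"
      unfolding d_Suc by (simp only: Suc.IH)
    also have "\<dots> = A ^ 2 * (d (Suc n) * (A ^ (p - 3)) ^ p ^ Suc n)"
    proof -
      have "(d n * (A ^ (p - 3)) ^ p ^ n) ^ p = d n ^ p * (A ^ (p - 3)) ^ p ^ Suc n"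
        by (simp only: power_mult_distrib power_mult[symmetric] power_Suc2 mult.assoc)
      then show ?thesis
        by (simp only: d_Suc[symmetric] mult.assoc)
    qed
    finally show ?case
      using A by simp
  qed
  then show *: "d (Suc n) = d n * (abs_val (f $ 3) ^ (p - 3)) ^ p ^ n" for n
    unfolding A_def .
  show "d n > 0"
    using A by (induction n) (simp_all add: d0 * A_def[symmetric])
qed

end

section \<open>Divisibility between iterates\<close>

text \<open>
  Each further iteration adds a difference quotient with constant term \<open>1\<close>.  For \<open>n\<close> prime to
  the characteristic the cofactor is therefore a unit: \<open>\<phi>\<close> and its \<open>n\<close>-th iterate have the same
  fixed points.
\<close>

lemma iter_minus_X_factor:
  fixes \<phi> :: "'k::ultrametric_field fps"
  assumes "integral_fps \<phi>" and "\<phi> $ 0 = 0" and "\<phi> $ 1 = 1"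
  shows "\<exists>T. integral_fps T \<and> T $ 0 = of_nat n \<and> fps_iter \<phi> n - fps_X = (\<phi> - fps_X) * T"
proof (induction n)
  case 0
  show ?case
    by (rule exI[of _ 0]) (simp add: integral_fps_0 fps_iter_0)
next
  case (Suc n)
  then obtain T where T: "integral_fps T" "T $ 0 = of_nat n"
    "fps_iter \<phi> n - fps_X = (\<phi> - fps_X) * T"
    by blast
  define S where "S = diff_quot (fps_iter \<phi> n) \<phi>"
  have "fps_iter \<phi> (Suc n) = fps_iter \<phi> n oo \<phi>"
    by (metis fps_iter_Suc fps_iter_commute assms(2))
  then have "fps_iter \<phi> (Suc n) - fps_X
    = ((fps_iter \<phi> n oo \<phi>) - fps_iter \<phi> n) + (fps_iter \<phi> n - fps_X)"
    by simp
  also have "\<dots> = (\<phi> - fps_X) * (S + T)"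
    unfolding T(3) diff_quot[OF assms(2)] S_def by (rule distrib_left[symmetric])
  finally have "fps_iter \<phi> (Suc n) - fps_X = (\<phi> - fps_X) * (S + T)" .
  moreover have "integral_fps (S + T)"
    unfolding S_def using T(1) assms(1)
    by (intro integral_fps_add integral_fps_diff_quot integral_fps_iter)
  moreover have "(S + T) $ 0 = of_nat (Suc n)"
    using T(2) fps_iter_nth_1[OF assms(2,3), of n]
    by (simp add: S_def diff_quot_nth_0[OF assms(2)])
  ultimately show ?case
    by blast
qed

lemma fixed_point_of_iter_coprime:
  fixes \<phi> :: "'k::ultrametric_field fps"
  assumes \<phi>: "integral_fps \<phi>" "\<phi> $ 0 = 0" "\<phi> $ 1 = 1" and "abs_val z < 1"
    and "prime CHAR('k)" "\<not> CHAR('k) dvd t"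
    and "evals \<phi> z w" and "evals (fps_iter \<phi> t) z z"
  shows "w = z"
proof -
  obtain T where T: "integral_fps T" "T $ 0 = of_nat t"
    "fps_iter \<phi> t - fps_X = (\<phi> - fps_X) * T"
    using iter_minus_X_factor[OF \<phi>] by blast
  have unit: "abs_val (T $ 0) = 1"
    unfolding T(2) using assms(5,6) by (rule abs_val_of_nat_eq_1)
  then have "T $ 0 \<noteq> 0"
    by auto
  then have "(fps_iter \<phi> t - fps_X) * inverse T = \<phi> - fps_X"
    unfolding T(3) by (simp add: mult.assoc inverse_mult_eq_1' del: mult_cancel_left)
  moreover have "evals ((fps_iter \<phi> t - fps_X) * inverse T) z 0"
    using evals_diff[OF assms(8) evals_X] T(1) unit
    by (intro evals_mult_0 integral_fps_inverse) simp_all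
  moreover have "evals (\<phi> - fps_X) z (w - z)"
    using assms(7) evals_X by (rule evals_diff)
  ultimately have "w - z = 0"
    using evals_unique[of "\<phi> - fps_X" z "w - z" 0] assms(4) by simp
  then show ?thesis
    by simp
qed

section \<open>Reduction\<close>

lemma residue_class_add:
  assumes "abs_val x \<le> 1" and "abs_val y \<le> 1"
  shows "residue_class (x + y) = residue_class x + residue_class y"
  using assms by (simp add: plus_residue.abs_eq residue_rel_iff)

lemma residue_class_mult:
  assumes "abs_val x \<le> 1" and "abs_val y \<le> 1"
  shows "residue_class (x * y) = residue_class x * residue_class y"
  using assms by (simp add: times_residue.abs_eq residue_rel_iff)

lemma residue_class_diff:
  assumes "abs_val x \<le> 1" and "abs_val y \<le> 1"
  shows "residue_class (x - y) = residue_class x - residue_class y"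
  using assms by (simp add: minus_residue.abs_eq residue_rel_iff)

lemma residue_class_eq_0_iff:
  "abs_val x \<le> 1 \<Longrightarrow> residue_class x = 0 \<longleftrightarrow> abs_val x < 1"
  using residue_class_eq_iff[of x 0]
  by (simp add: zero_residue_def integral_elems_def max_ideal_def)

lemma residue_class_sum:
  assumes "\<And>i. i \<in> A \<Longrightarrow> abs_val (g i) \<le> 1"
  shows "residue_class (sum g A) = (\<Sum>i\<in>A. residue_class (g i))"
  using assms
proof (induction A rule: infinite_finite_induct)
  case (insert x A)
  then have "abs_val (sum g A) \<le> 1"
    by (intro abs_val_sum_le) auto
  with insert show ?case
    by (simp add: residue_class_add)
qed (simp_all add: zero_residue_def)

lemma reduce_fps_nth: "reduce_fps f $ n = residue_class (f $ n)"
  by (simp add: reduce_fps_def)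

lemma reduce_fps_mult:
  assumes "integral_fps f" and "integral_fps g"
  shows "reduce_fps (f * g) = reduce_fps f * reduce_fps g"
  using assms
  by (intro fps_ext) (simp add: reduce_fps_nth fps_mult_nth integral_fps_def residue_class_sum
      residue_class_mult abs_val_mult_le_1)

lemma reduce_fps_diff:
  assumes "integral_fps f" and "integral_fps g"
  shows "reduce_fps (f - g) = reduce_fps f - reduce_fps g"
  using assms by (intro fps_ext) (simp add: reduce_fps_nth integral_fps_def residue_class_diff)

lemma reduce_fps_1: "reduce_fps 1 = 1"
  by (intro fps_ext) (simp add: reduce_fps_nth zero_residue_def one_residue_def)

lemma reduce_fps_X_minus_const:
  assumes "abs_val z < 1"
  shows "reduce_fps (fps_X - fps_const z) = fps_X"
proof (rule fps_ext)
  fix n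
  have "residue_class (- z) = 0"
    using assms by (simp add: residue_class_eq_0_iff)
  then show "reduce_fps (fps_X - fps_const z) $ n = fps_X $ n"
    by (simp add: reduce_fps_nth zero_residue_def one_residue_def fps_X_def)
qed

lemma reduce_fps_X: "reduce_fps fps_X = fps_X"
  using reduce_fps_X_minus_const[of 0] by simp

lemma reduce_fps_power:
  assumes "integral_fps f"
  shows "reduce_fps (f ^ n) = reduce_fps f ^ n"
  by (induction n) (simp_all add: reduce_fps_1 reduce_fps_mult integral_fps_power assms)

lemma reduce_fps_compose:
  assumes "integral_fps f" and "integral_fps g"
  shows "reduce_fps (f oo g) = reduce_fps f oo reduce_fps g"
proof (rule fps_ext)
  fix n
  have f: "abs_val (f $ i) \<le> 1" and g: "abs_val ((g ^ i) $ n) \<le> 1" for i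
    using assms(1) integral_fps_power[OF assms(2), of i] by (auto simp: integral_fps_def)
  have "residue_class ((g ^ i) $ n) = (reduce_fps g ^ i) $ n" for i
    using reduce_fps_power[OF assms(2), of i] by (metis reduce_fps_nth)
  then show "reduce_fps (f oo g) $ n = (reduce_fps f oo reduce_fps g) $ n"
    using f g by (simp add: reduce_fps_nth fps_compose_nth residue_class_sum residue_class_mult
        abs_val_mult_le_1)
qed

lemma reduce_fps_iter:
  assumes "integral_fps f"
  shows "reduce_fps (fps_iter f m) = fps_iter (reduce_fps f) m"
  using assms
  by (induction m)
    (simp_all add: fps_iter_0 fps_iter_Suc reduce_fps_X reduce_fps_compose integral_fps_iter)

lemma reduce_fps_prod_X_minus_const:
  assumes "\<And>z. z \<in> Z \<Longrightarrow> abs_val z < 1"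
  shows "integral_fps (\<Prod>z\<in>Z. fps_X - fps_const z) \<and>
    reduce_fps (\<Prod>z\<in>Z. fps_X - fps_const z) = fps_X ^ card Z"
  using assms
proof (induction Z rule: infinite_finite_induct)
  case (insert z Z)
  have "integral_fps (fps_const z)"
    using insert.prems[of z] by (auto simp: integral_fps_def)
  then have "integral_fps (fps_X - fps_const z)"
    by (intro integral_fps_diff integral_fps_X)
  with insert show ?case
    by (simp add: integral_fps_mult reduce_fps_mult reduce_fps_X_minus_const)
qed (simp_all add: integral_fps_1 reduce_fps_1)

lemma lower_ram_eq_enatD:
  fixes g :: "'a::field fps"
  assumes "lower_ram g n = enat b" and "g $ 0 = 0"
  shows "fps_iter g (CHAR('a) ^ n) - fps_X \<noteq> 0"
    and "subdegree (fps_iter g (CHAR('a) ^ n) - fps_X) = b + 1"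
proof -
  define F where "F = fps_iter g (CHAR('a) ^ n) - fps_X"
  have "F $ 0 = 0"
    unfolding F_def by (simp add: fps_iter_nth_0 assms(2))
  then have F: "F = fps_X * fps_shift 1 F"
    by (intro fps_ext) (simp add: fps_X_mult_nth)
  have "F / fps_X = fps_shift 1 F"
    by (subst F) (rule nonzero_mult_div_cancel_left, simp)
  then have ord: "fps_ord (fps_shift 1 F) = enat b"
    using assms(1) unfolding lower_ram_def F_def by simp
  then have G: "fps_shift 1 F \<noteq> 0" "subdegree (fps_shift 1 F) = b"
    by (auto simp: fps_ord_def split: if_splits)
  then have "F \<noteq> 0"
    by (metis fps_shift_zero)
  moreover have "subdegree F = b + 1"
    by (subst F, subst subdegree_mult) (use G in simp_all)
  ultimately show "fps_iter g (CHAR('a) ^ n) - fps_X \<noteq> 0"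
    "subdegree (fps_iter g (CHAR('a) ^ n) - fps_X) = b + 1"
    unfolding F_def by this
qed

section \<open>Cycles\<close>

text \<open>
  The minimal period of a point of the open unit disk is a power of the characteristic, since
  removing a factor prime to it from a period leaves a period.  Every point of the cycle has the
  same minimal period \<open>p ^ Suc n\<close>.
\<close>

lemma cycle_structure:
  fixes f :: "'k::ultrametric_field fps" and z :: 'k
  assumes f: "integral_fps f" "f $ 0 = 0" "f $ 1 = 1"
    and p: "prime p" "CHAR('k) = p" and z: "abs_val z < 1"
    and "periodic_point f z" and "\<not> fixed_point f z"
  defines "orb \<equiv> \<lambda>i. (fps_value f ^^ i) z"
  obtains n where "\<And>i m. evals (fps_iter f m) (orb i) (orb (i + m))"
    and "\<And>i. abs_val (orb i) = abs_val z"
    and "\<And>i. orb (i + p ^ Suc n) = orb i"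
    and "\<And>i. i < p ^ Suc n \<Longrightarrow> orb (i + p ^ n) \<noteq> orb i"
    and "inj_on orb {..<p ^ Suc n}"
proof -
  obtain m where m: "m \<ge> 1" "\<forall>i<m. fps_conv_at f (orb i)" "orb m = z"
    using assms(7) unfolding periodic_point_def orb_def by blast
  have orb_0: "orb 0 = z" and orb_Suc: "orb (Suc i) = fps_value f (orb i)" for i
    by (simp_all add: orb_def)
  have orb_add: "orb (i + l) = (fps_value f ^^ i) (orb l)" for i l
    by (simp add: orb_def funpow_add)
  have shift: "orb (i + N) = orb (i + M)" if "orb N = orb M" for i N M
    unfolding orb_add that ..
  have conv: "fps_conv_at f (orb i)" for i
  proof -
    have "orb (q * m + r) = orb r" for q r
    proof (induction q)
      case (Suc q)
      have "orb ((q * m + r) + m) = orb ((q * m + r) + 0)"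
        by (rule shift) (simp only: m(3) orb_0)
      then show ?case
        using Suc.IH by (simp add: ac_simps)
    qed simp
    from this[of "i div m" "i mod m"] have "orb i = orb (i mod m)"
      by simp
    then show ?thesis
      using m(1,2) by simp
  qed
  have abs: "abs_val (orb i) = abs_val z" for i
  proof (induction i)
    case (Suc i)
    have "evals f (orb i) (orb (Suc i))"
      unfolding orb_Suc using f(1) conv Suc.IH z by (intro evals_fps_value) simp_all
    then show ?case
      using abs_val_evals[OF _ f(2,3)] Suc.IH z by simp
  qed (simp add: orb_0)
  have ev1: "evals f (orb i) (orb (Suc i))" for i
    unfolding orb_Suc using f(1) conv abs z by (intro evals_fps_value) simp_all
  have ev: "evals (fps_iter f l) (orb i) (orb (i + l))" for i l
  proof (induction l)
    case (Suc l)
    have "evals (f oo fps_iter f l) (orb i) (orb (Suc (i + l)))"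
      using Suc f by (intro evals_compose[OF ev1]) (simp_all add: fps_iter_nth_0 integral_fps_iter)
    then show ?case
      by (simp add: fps_iter_Suc)
  qed (simp add: fps_iter_0 evals_X)
  have p_part: "\<exists>k. p ^ k \<le> N \<and> orb (p ^ k) = z" if "orb N = z" "N > 0" for N
  proof -
    obtain k t where t: "\<not> p dvd t" "N = t * p ^ k"
      using prime_power_canonical[OF p(1) \<open>N > 0\<close>] by blast
    define \<phi> where "\<phi> = fps_iter f (p ^ k)"
    have "evals (fps_iter f N) (orb 0) (orb (0 + N))"
      by (rule ev)
    then have "evals (fps_iter \<phi> t) z z"
      unfolding \<phi>_def fps_iter_mult[OF f(2)] using that(1) t(2) by (simp add: orb_0 mult.commute)
    moreover have "evals \<phi> z (orb (p ^ k))"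
      using ev[of "p ^ k" 0] by (simp add: \<phi>_def orb_0)
    moreover have "integral_fps \<phi>" "\<phi> $ 0 = 0" "\<phi> $ 1 = 1"
      unfolding \<phi>_def
      by (rule integral_fps_iter[OF f(1)], rule fps_iter_nth_0[OF f(2)],
          rule fps_iter_nth_1[OF f(2,3)])
    ultimately have "orb (p ^ k) = z"
      using fixed_point_of_iter_coprime[of \<phi> z t] z p t(1) by blast
    moreover have "t \<noteq> 0"
      using t that(2) by (cases t) auto
    then have "p ^ k \<le> N"
      using t(2) by simp
    ultimately show ?thesis
      by blast
  qed
  define s where "s = (LEAST s. orb (p ^ s) = z)"
  have "\<exists>s. orb (p ^ s) = z"
    using p_part[OF m(3)] m(1) by auto
  then have s: "orb (p ^ s) = z"
    unfolding s_def by (rule LeastI_ex)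
  have least: "s \<le> k" if "orb (p ^ k) = z" for k
    unfolding s_def using that by (rule Least_le)
  have "orb 1 \<noteq> z"
    using assms(8) conv[of 0] unfolding fixed_point_def by (simp add: orb_def)
  then obtain n where n: "s = Suc n"
    using s by (cases s) auto
  have per: "orb (i + p ^ Suc n) = orb i" for i
    using shift[of "p ^ Suc n" 0 i] s n by (simp add: orb_0)
  have return: "orb d = z" if "orb (i + d) = orb i" "i \<le> p ^ Suc n" for i d
  proof -
    have "orb ((p ^ Suc n - i) + (i + d)) = orb ((p ^ Suc n - i) + i)"
      by (rule shift) (rule that)
    moreover have "(p ^ Suc n - i) + (i + d) = d + p ^ Suc n" "(p ^ Suc n - i) + i = 0 + p ^ Suc n"
      using that(2) by simp_all
    ultimately show ?thesis
      using per[of d] per[of 0] by (simp only: orb_0)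
  qed
  have minimal: "orb (i + p ^ n) \<noteq> orb i" if "i < p ^ Suc n" for i
    using return[of i "p ^ n"] least[of n] that n by auto
  have "inj_on orb {..<p ^ Suc n}"
  proof (rule linorder_inj_onI)
    fix i l assume "i < l" and "i \<in> {..<p ^ Suc n}" "l \<in> {..<p ^ Suc n}"
    then have l: "i < p ^ Suc n" "l < p ^ Suc n"
      by auto
    show "orb i \<noteq> orb l"
    proof
      assume "orb i = orb l"
      then have "orb (l - i) = z"
        using return[of i "l - i"] \<open>i < l\<close> l by simp
      then obtain k where "p ^ k \<le> l - i" "orb (p ^ k) = z"
        using p_part[of "l - i"] \<open>i < l\<close> by auto
      then have "p ^ Suc n \<le> p ^ k"
        using least[of k] n prime_gt_0_nat[OF p(1)] by (intro power_increasing) auto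
      then show False
        using \<open>p ^ k \<le> l - i\<close> l by linarith
    qed
  qed auto
  with that[of n] ev abs per minimal show thesis
    by blast
qed

text \<open>
  Dividing out the zeros in \<open>Z\<close> leaves the order of \<open>Q\<close> unchanged but lowers the order of its
  reduction by \<open>card Z\<close>.  The orders of the remaining factor and of its reduction thus agree: its
  leading coefficient is a unit.
\<close>

lemma abs_val_cycle:
  fixes Q :: "'k::ultrametric_field fps"
  assumes "integral_fps Q" and "finite Z"
    and Z: "\<And>z. z \<in> Z \<Longrightarrow> evals Q z 0" "\<And>z. z \<in> Z \<Longrightarrow> abs_val z = r" and r: "0 < r" "r < 1"
    and "Q \<noteq> 0" and "reduce_fps Q \<noteq> 0" and ord: "subdegree (reduce_fps Q) = subdegree Q + card Z"
  shows "abs_val (Q $ subdegree Q) = r ^ card Z"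
proof -
  define P where "P = (\<Prod>z\<in>Z. fps_X - fps_const z)"
  obtain h where h: "integral_fps h" "Q = P * h"
    unfolding P_def using evals_0_factor[OF assms(2,1)] Z r(2) by metis
  have P: "integral_fps P" "reduce_fps P = fps_X ^ card Z"
    unfolding P_def using reduce_fps_prod_X_minus_const[of Z] Z(2) r(2) by auto
  have "P $ 0 = (\<Prod>z\<in>Z. - z)"
    unfolding P_def by (induction Z rule: infinite_finite_induct) simp_all
  then have P0: "abs_val (P $ 0) = r ^ card Z"
    using Z(2) by (simp add: abs_val_prod)
  then have "P $ 0 \<noteq> 0"
    using r(1) by auto
  then have "subdegree P = 0" "P \<noteq> 0"
    by (auto simp: subdegree_eq_0_iff)
  then have sub: "subdegree Q = subdegree h"
    using \<open>Q \<noteq> 0\<close> h(2) by simp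
  have red: "reduce_fps Q = fps_X ^ card Z * reduce_fps h"
    using h P by (simp add: reduce_fps_mult)
  then have "reduce_fps h \<noteq> 0"
    using assms(8) by auto
  then have "subdegree (reduce_fps h) = subdegree Q"
    using ord red by simp
  then have "residue_class (h $ subdegree Q) \<noteq> 0"
    using \<open>reduce_fps h \<noteq> 0\<close> by (metis nth_subdegree_nonzero reduce_fps_nth)
  then have "abs_val (h $ subdegree Q) = 1"
    using h(1) residue_class_eq_0_iff[of "h $ subdegree Q"]
    unfolding integral_fps_def by (metis order_le_imp_less_or_eq)
  moreover have "Q $ subdegree Q = P $ 0 * h $ subdegree Q"
    using nth_subdegree_mult[of P h] \<open>subdegree P = 0\<close> h(2) sub \<open>Q \<noteq> 0\<close> by simp
  ultimately show ?thesis
    by (simp add: abs_val_mult P0)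
qed

theorem corollaryA:
  fixes p :: nat
    and f :: "'k::ultrametric_field fps"
    and a :: "nat \<Rightarrow> 'k"
    and lam :: 'k
  assumes "prime p" and "p \<ge> 5"
    and "CHAR('k) = p"
    and "\<And>n. fps_nth f n \<in> integral_elems"
    and "f = fps_X * (1 + Abs_fps (\<lambda>j. if j \<ge> 2 then a j else 0))"
    and "lam = a 2 ^ (p - 3) * (3 / 2 * a 2 ^ 3 + a 3 ^ 2 - a 2 * a 4)"
    and "lam \<noteq> 0"
    and "b_ramified 3 (reduce_fps f)"
  shows "{z \<in> max_ideal. periodic_point f z \<and> \<not> fixed_point f z}
    \<subseteq> {z. abs_val z = abs_val lam powr (1 / real p)}"
proof
  fix z assume "z \<in> {z \<in> max_ideal. periodic_point f z \<and> \<not> fixed_point f z}"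
  then have z: "abs_val z < 1" "periodic_point f z" "\<not> fixed_point f z"
    by (auto simp: max_ideal_def)
  note p = assms(1-3)
  have coeff: "f $ 0 = 0" "f $ 1 = 1" "f $ 2 = 0" "f $ 3 = a 2" "f $ 4 = a 3" "f $ 5 = a 4"
    unfolding assms(5) by (simp_all add: fps_X_mult_nth)
  have int: "integral_fps f"
    using assms(4) by (simp add: integral_fps_def integral_elems_def)
  have "0 < p"
    using p(2) by simp
  have char: "CHAR('k residue) = p"
    using CHAR_residue p by metis
  have red_0: "reduce_fps f $ 0 = 0"
    by (simp add: reduce_fps_nth coeff zero_residue_def)
  have red: "reduce_fps (fps_iter f (p ^ n) - fps_X) \<noteq> 0"
    "subdegree (reduce_fps (fps_iter f (p ^ n) - fps_X)) = 3 * (\<Sum>i\<le>n. p ^ i) + 1" for n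
  proof -
    have "lower_ram (reduce_fps f) n = enat (3 * (\<Sum>i\<le>n. p ^ i))"
      using assms(8) unfolding b_ramified_def char by blast
    note L = lower_ram_eq_enatD[OF this red_0, unfolded char]
    moreover have "reduce_fps (fps_iter f (p ^ n) - fps_X) = fps_iter (reduce_fps f) (p ^ n) - fps_X"
      using int by (simp add: reduce_fps_diff reduce_fps_iter reduce_fps_X integral_fps_iter
          integral_fps_X)
    ultimately show "reduce_fps (fps_iter f (p ^ n) - fps_X) \<noteq> 0"
      "subdegree (reduce_fps (fps_iter f (p ^ n) - fps_X)) = 3 * (\<Sum>i\<le>n. p ^ i) + 1"
      by simp_all
  qed
  have coeff_le: "abs_val (f $ i) \<le> 1" for i
    using int by (simp add: integral_fps_def)
  have iter_1: "fps_iter f (p ^ 0) = f"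
    using fps_iter_1[of f] by simp
  \<comment> \<open>The reduction of \<open>f - X\<close> starts in degree \<open>4\<close>, where \<open>a 3\<close> stands.\<close>
  have red_f: "reduce_fps (f - fps_X) \<noteq> 0" "subdegree (reduce_fps (f - fps_X)) = 4"
    using red[of 0] unfolding iter_1 by simp_all
  have "reduce_fps (f - fps_X) $ 3 = 0"
    using red_f(2) by (intro nth_less_subdegree_zero) simp
  then have "residue_class (f $ 3) = 0"
    by (simp add: reduce_fps_nth)
  then have a2: "abs_val (a 2) < 1"
    using residue_class_eq_0_iff[OF coeff_le[of 3]] coeff by simp
  have "reduce_fps (f - fps_X) $ 4 \<noteq> 0"
    using red_f nth_subdegree_nonzero by metis
  then have "residue_class (f $ 4) \<noteq> 0"
    by (simp add: reduce_fps_nth)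
  then have a3: "abs_val (a 3) = 1"
    using residue_class_eq_0_iff[OF coeff_le[of 4]] coeff coeff_le[of 4] by simp
  have a2_nz: "a 2 \<noteq> 0"
    using assms(6,7) p(2) by auto
  have lam: "abs_val lam = abs_val (a 2) ^ (p - 3)"
  proof -
    have two: "abs_val (2 :: 'k) = 1"
    proof -
      have "\<not> p dvd 2"
        using p(2) by (auto dest: dvd_imp_le)
      then show ?thesis
        using abs_val_of_nat_eq_1[of 2, where ?'k='k] p(1,3) by simp
    qed
    have three: "abs_val (3 :: 'k) \<le> 1"
      using abs_val_of_nat_le_1[of 3, where ?'k='k] by simp
    have "abs_val (inverse (2 :: 'k)) = 1"
      by (simp only: abs_val_inverse two inverse_1)
    then have "abs_val (3 / 2 * a 2 ^ 2 - a 4) \<le> 1"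
      unfolding divide_inverse power2_eq_square
      using three a2 coeff_le[of 5] coeff(6)
      by (intro abs_val_diff_le abs_val_mult_le_1) simp_all
    then have "abs_val (a 2 * (3 / 2 * a 2 ^ 2 - a 4)) < 1"
      using a2 abs_val_nonneg
      by (metis abs_val_mult le_less_trans mult_right_le_one_le)
    then have "abs_val (a 3 ^ 2 + a 2 * (3 / 2 * a 2 ^ 2 - a 4)) = 1"
      using a3 by (simp add: abs_val_add_eq abs_val_power)
    moreover have "3 / 2 * a 2 ^ 3 + a 3 ^ 2 - a 2 * a 4
      = a 3 ^ 2 + a 2 * (3 / 2 * a 2 ^ 2 - a 4)"
      by (simp add: algebra_simps power2_eq_square power3_eq_cube)
    ultimately have "abs_val (3 / 2 * a 2 ^ 3 + a 3 ^ 2 - a 2 * a 4) = 1"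
      by (simp only:)
    then show ?thesis
      unfolding assms(6) abs_val_mult[of "_ ^ (p - 3)"] abs_val_power by simp
  qed
  define orb where "orb i = (fps_value f ^^ i) z" for i
  obtain n where ev: "\<And>i m. evals (fps_iter f m) (orb i) (orb (i + m))"
    and abs: "\<And>i. abs_val (orb i) = abs_val z"
    and per: "\<And>i. orb (i + p ^ Suc n) = orb i"
    and min: "\<And>i. i < p ^ Suc n \<Longrightarrow> orb (i + p ^ n) \<noteq> orb i"
    and inj: "inj_on orb {..<p ^ Suc n}"
    unfolding orb_def
    using cycle_structure[OF int coeff(1,2) p(1,3) z] by blast
  define \<phi> where "\<phi> = fps_iter f (p ^ n)"
  have \<phi>: "integral_fps \<phi>" "\<phi> $ 0 = 0" "\<phi> $ 1 = 1"
    unfolding \<phi>_def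
    by (rule integral_fps_iter[OF int], rule fps_iter_nth_0[OF coeff(1)],
        rule fps_iter_nth_1[OF coeff(1,2)])
  have iter: "fps_iter \<phi> p = fps_iter f (p ^ Suc n)"
    unfolding \<phi>_def using coeff(1) by (simp add: fps_iter_mult mult.commute)
  obtain Q where Q: "integral_fps Q" "fps_iter f (p ^ Suc n) - fps_X = (\<phi> - fps_X) * Q"
    using iter_minus_X_factor[OF \<phi>, of p] unfolding iter by blast
  define Z where "Z = orb ` {..<p ^ Suc n}"
  have card: "card Z = p ^ Suc n" "finite Z"
    unfolding Z_def using card_image[OF inj] by simp_all
  have zeros: "evals Q y 0" if "y \<in> Z" for y
  proof -
    obtain i where y: "y = orb i" and "i < p ^ Suc n"
      using \<open>y \<in> Z\<close> unfolding Z_def by blast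
    show ?thesis
    proof (rule evals_mult_0_cancel)
      show "evals (\<phi> - fps_X) y (orb (i + p ^ n) - orb i)"
        unfolding y \<phi>_def by (intro evals_diff ev evals_X)
      show "orb (i + p ^ n) - orb i \<noteq> 0"
        using min[OF \<open>i < p ^ Suc n\<close>] by simp
      have "evals (fps_iter f (p ^ Suc n) - fps_X) y (orb (i + p ^ Suc n) - orb i)"
        unfolding y by (intro evals_diff ev evals_X)
      then show "evals ((\<phi> - fps_X) * Q) y 0"
        unfolding Q(2) per by simp
      show "abs_val y < 1"
        unfolding y abs by (rule z(1))
    qed (rule Q(1))
  qed
  have "z \<noteq> 0"
    using min[of 0] abs \<open>0 < p\<close> by (metis zero_less_power abs_val_eq_0_iff abs_val_zero)
  then have r: "0 < abs_val z"
    by (metis abs_val_eq_0_iff abs_val_nonneg less_eq_real_def)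
  define j where "j n = 2 * (\<Sum>i\<le>n. p ^ i) + 1" for n
  define d where "d n = (fps_iter f (p ^ n) - fps_X) $ j n" for n
  have f': "f $ 3 \<noteq> 0" "abs_val (f $ 3) < 1" "abs_val (f $ 4) = 1"
    using a2_nz a2 a3 coeff by simp_all
  note low = iter_p_power_leading_coeff(1)[OF int coeff(1-3) f' p, folded j_def]
  note ratio = iter_p_power_leading_coeff_ratio[OF int coeff(1-3) f' p, folded j_def, folded d_def,
      unfolded coeff(4), folded lam]
  have d_nz: "d n \<noteq> 0" for n
    using ratio(1)[of n] by auto
  have sub: "subdegree (fps_iter f (p ^ n) - fps_X) = j n" for n
    using d_nz[of n, unfolded d_def] low[of n] by (intro subdegreeI) blast+
  have iter_nz: "fps_iter f (p ^ n) - fps_X \<noteq> 0" for n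
    using d_nz[of n, unfolded d_def] by (metis fps_zero_nth)
  define F G where "F = fps_iter f (p ^ Suc n) - fps_X" and "G = fps_iter f (p ^ n) - fps_X"
  have FGQ: "F = G * Q"
    using Q(2) unfolding F_def G_def \<phi>_def .
  have nz: "F \<noteq> 0" "G \<noteq> 0"
    unfolding F_def G_def by (rule iter_nz)+
  then have Q_nz: "Q \<noteq> 0"
    unfolding FGQ by (metis mult_zero_right)
  have sub_FGQ: "subdegree F = subdegree G + subdegree Q"
    unfolding FGQ by (rule subdegree_mult[OF nz(2) Q_nz])
  have "j (Suc n) = j n + 2 * p ^ Suc n"
    by (simp add: j_def)
  then have sub_Q: "subdegree Q = 2 * p ^ Suc n"
    using sub_FGQ unfolding F_def G_def sub by simp
  have "F $ subdegree F = G $ subdegree G * Q $ subdegree Q"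
    unfolding sub_FGQ unfolding FGQ by (rule nth_subdegree_mult)
  moreover have "F $ subdegree F = d (Suc n)" "G $ subdegree G = d n"
    unfolding F_def G_def sub d_def by (rule refl)+
  ultimately have "abs_val (d n) * abs_val (Q $ subdegree Q) = abs_val (d n) * abs_val lam ^ p ^ n"
    using ratio(2)[of n] by (simp only: abs_val_mult)
  then have lead_Q: "abs_val (Q $ subdegree Q) = abs_val lam ^ p ^ n"
    using ratio(1)[of n] by simp
  have "integral_fps G"
    unfolding G_def using int by (intro integral_fps_diff integral_fps_iter integral_fps_X)
  then have red_FGQ: "reduce_fps F = reduce_fps G * reduce_fps Q"
    unfolding FGQ using Q(1) by (rule reduce_fps_mult)
  note red_F = red[of "Suc n", folded F_def] and red_G = red[of n, folded G_def]
  have red_Q_nz: "reduce_fps Q \<noteq> 0"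
    using red_F(1) unfolding red_FGQ by (metis mult_zero_right)
  have "subdegree (reduce_fps F) = subdegree (reduce_fps G) + subdegree (reduce_fps Q)"
    unfolding red_FGQ by (rule subdegree_mult[OF red_G(1) red_Q_nz])
  then have "subdegree (reduce_fps Q) = subdegree Q + card Z"
    unfolding sub_Q card red_F(2) red_G(2) by simp
  moreover have "abs_val y = abs_val z" if "y \<in> Z" for y
    using that abs unfolding Z_def by blast
  ultimately have "abs_val lam ^ p ^ n = abs_val z ^ p ^ Suc n"
    using abs_val_cycle[OF Q(1) card(2) zeros _ r z(1) Q_nz red_Q_nz] unfolding card lead_Q by blast
  then have "abs_val lam ^ p ^ n = (abs_val z ^ p) ^ p ^ n"
    by (simp only: power_mult power_Suc)
  then have "abs_val lam = abs_val z ^ p"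
    by (rule power_eq_imp_eq_base) (use \<open>0 < p\<close> in \<open>simp_all add: abs_val_nonneg\<close>)
  also have "\<dots> = abs_val z powr real p"
    using r by (simp add: powr_realpow)
  finally have "abs_val lam powr (1 / real p) = abs_val z"
    using r \<open>0 < p\<close> by (simp add: powr_powr)
  then show "z \<in> {z. abs_val z = abs_val lam powr (1 / real p)}"
    by simp
qed

end
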